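(* Let $k\ge3$ and $0\le\alpha<1$. Let $T$ be a $k$-uniform supertree on $n$ vertices with $m$ edges, and suppose that $T\ncong K_{1,m}^k$. Then $$\rho_\alpha(T)\le\rho_\alpha(S^k(1,m-2)),$$ where equality holds if and only if $T\cong S^k(1,m-2)$.
   Context: A $k$-uniform hypergraph has a finite vertex set and an edge set that is a collection of $k$-subsets of the vertex set (no repeated edges). A supertree is a hypergraph that is connected and acyclic (no cycle $v_1e_1v_2e_2\dots v_\ell e_\ell v_1$ with $\ell\ge2$, distinct vertices $v_i$ and distinct edges $e_i$, $v_i,v_{i+1}\in e_i$, indices mod $\ell$). The $k$-th power of a simple graph is the $k$-uniform hypergraph obtained by adding $k-2$ new vertices (of degree one) to each edge. $K_{1,m}^k$ is the $k$-th power of the star $K_{1,m}$ with $m$ edges. The double star $S(a,b)$ is the tree on $a+b+2$ vertices obtained from a single edge by attaching $a$ pendant edges to one end and $b$ pendant edges to the other end; $S^k(a,b)$ is its $k$-th power. (If $T\ncong K_{1,m}^k$ then $m\ge3$.) Spectral notation: for a $k$-uniform hypergraph $G$ with $V(G)=\{1,\dots,n\}$, $\mathcal A_\alpha(G)=\alpha\mathcal D(G)+(1-\alpha)\mathcal A(G)$, where $\mathcal D(G)$ is the diagonal tensor of order $k$ and dimension $n$ of vertex degrees and $\mathcal A(G)$ is the adjacency tensor with entries $a_{i_1\dots i_k}=\frac1{(k-1)!}$ if $\{i_1,\dots,i_k\}\in E(G)$ and $0$ otherwise; equivalently $(\mathcal A_\alpha(G)\boldsymbol x)_v=\alpha d_vx_v^{k-1}+(1-\alpha)\sum_{e\ni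 v}\prod_{w\in e\setminus\{v\}}x_w$, $d_v$ the degree of $v$. An eigenvalue is $\lambda\in\mathbb C$ with $\mathcal A_\alpha(G)\boldsymbol x=\lambda (x_i^{k-1})_i$ for some nonzero $\boldsymbol x\in\mathbb C^n$. The $\alpha$-spectral radius $\rho_\alpha(G)$ is the largest modulus of an eigenvalue of $\mathcal A_\alpha(G)$. *)

theory Defs
  imports Complex_Main
begin

record 'a hypergraph =
  verts :: "'a set"
  edges :: "'a set set"

definition uniform :: "nat \<Rightarrow> 'a hypergraph \<Rightarrow> bool" where
  "uniform k G \<longleftrightarrow> finite (verts G) \<and> (\<forall>e\<in>edges G. e \<subseteq> verts G \<and> card e = k)"

text \<open>The hypergraph with no vertices does not count as connected.\<close>

definition hconnected :: "'a hypergraph \<Rightarrow> bool" where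
  "hconnected G \<longleftrightarrow> verts G \<noteq> {} \<and>
     (\<forall>u\<in>verts G. \<forall>v\<in>verts G. (u, v) \<in> {(x, y). \<exists>e\<in>edges G. x \<in> e \<and> y \<in> e}\<^sup>*)"

definition is_cycle :: "'a hypergraph \<Rightarrow> 'a list \<Rightarrow> 'a set list \<Rightarrow> bool" where
  "is_cycle G vs es \<longleftrightarrow>
     length vs = length es \<and> 2 \<le> length es \<and> distinct vs \<and> distinct es \<and>
     set vs \<subseteq> verts G \<and> set es \<subseteq> edges G \<and>
     (\<forall>i<length es. vs ! i \<in> es ! i \<and> vs ! (Suc i mod length es) \<in> es ! i)"

definition hacyclic :: "'a hypergraph \<Rightarrow> bool" where
  "hacyclic G \<longleftrightarrow> (\<nexists>vs es. is_cycle G vs es)"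

definition supertree :: "nat \<Rightarrow> 'a hypergraph \<Rightarrow> bool" where
  "supertree k G \<longleftrightarrow> uniform k G \<and> hconnected G \<and> hacyclic G"

definition isomorphic :: "'a hypergraph \<Rightarrow> 'b hypergraph \<Rightarrow> bool" where
  "isomorphic G H \<longleftrightarrow>
     (\<exists>f. bij_betw f (verts G) (verts H) \<and> edges H = (\<lambda>e. f ` e) ` edges G)"

text \<open>
  A simple graph is a hypergraph all of whose edges have two elements.  In its
  \<open>k\<close>-th power the \<open>k - 2\<close> new vertices of an edge \<open>e\<close> are \<open>Inr (e, i)\<close> with \<open>i < k - 2\<close>.
\<close>

definition power_hypergraph :: "nat \<Rightarrow> 'a hypergraph \<Rightarrow> ('a + 'a set \<times> nat) hypergraph" where
  "power_hypergraph k G =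
     \<lparr> verts = verts G <+> edges G \<times> {..<k - 2},
       edges = (\<lambda>e. e <+> {e} \<times> {..<k - 2}) ` edges G \<rparr>"

definition star_graph :: "nat \<Rightarrow> nat hypergraph" where
  "star_graph m = \<lparr> verts = {0..m}, edges = (\<lambda>i. {0, i}) ` {1..m} \<rparr>"

text \<open>The two ends of the central edge are \<open>0\<close>, carrying \<open>a\<close> pendant edges, and \<open>1\<close>, carrying \<open>b\<close>.\<close>

definition double_star :: "nat \<Rightarrow> nat \<Rightarrow> nat hypergraph" where
  "double_star a b =
     \<lparr> verts = {0..a + b + 1},
       edges = {{0, 1}} \<union> (\<lambda>i. {0, i}) ` {2..a + 1} \<union> (\<lambda>j. {1, j}) ` {a + 2..a + b + 1} \<rparr>"

definition vertex_degree :: "'a hypergraph \<Rightarrow> 'a \<Rightarrow> nat" where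
  "vertex_degree G v = card {e \<in> edges G. v \<in> e}"

text \<open>
  A tensor of order \<open>k\<close> whose indices range over a set \<open>V\<close> is given by its entries, as a
  function of the index list \<open>[i\<^sub>1, \<dots>, i\<^sub>k]\<close>; only lists of length \<open>k\<close> over \<open>V\<close> matter.
  The tensors of a hypergraph are indexed by its vertices themselves.
\<close>

definition degree_tensor :: "nat \<Rightarrow> 'a hypergraph \<Rightarrow> 'a list \<Rightarrow> real" where
  "degree_tensor k G is = (if is = replicate k (hd is) then real (vertex_degree G (hd is)) else 0)"

definition adjacency_tensor :: "nat \<Rightarrow> 'a hypergraph \<Rightarrow> 'a list \<Rightarrow> real" where
  "adjacency_tensor k G is = (if length is = k \<and> set is \<in> edges G then 1 / fact (k - 1) else 0)"

definition A_tensor :: "nat \<Rightarrow> real \<Rightarrow> 'a hypergraph \<Rightarrow> 'a list \<Rightarrow> real" where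
  "A_tensor k \<alpha> G is = \<alpha> * degree_tensor k G is + (1 - \<alpha>) * adjacency_tensor k G is"

definition tensor_apply :: "nat \<Rightarrow> 'a set \<Rightarrow> ('a list \<Rightarrow> real) \<Rightarrow> ('a \<Rightarrow> complex) \<Rightarrow> 'a \<Rightarrow> complex" where
  "tensor_apply k V A x i =
     (\<Sum>js | set js \<subseteq> V \<and> length js = k - 1. of_real (A (i # js)) * prod_list (map x js))"

definition tensor_eigenvalue :: "nat \<Rightarrow> 'a set \<Rightarrow> ('a list \<Rightarrow> real) \<Rightarrow> complex \<Rightarrow> bool" where
  "tensor_eigenvalue k V A \<mu> \<longleftrightarrow>
     (\<exists>x. (\<exists>i\<in>V. x i \<noteq> 0) \<and> (\<forall>i\<in>V. tensor_apply k V A x i = \<mu> * x i ^ (k - 1)))"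

definition alpha_spectral_radius :: "nat \<Rightarrow> real \<Rightarrow> 'a hypergraph \<Rightarrow> real" where
  "alpha_spectral_radius k \<alpha> G =
     (GREATEST r. \<exists>\<mu>. tensor_eigenvalue k (verts G) (A_tensor k \<alpha> G) \<mu> \<and> r = cmod \<mu>)"

end

theory Submission
  imports Defs "HOL-Analysis.Function_Topology" "HOL-Combinatorics.Multiset_Permutations"
begin

text \<open>
  On a connected \<open>k\<close>-uniform hypergraph the \<open>\<alpha>\<close>-spectral radius is the maximum of
  \<open>\<Sum>\<^sub>e (\<alpha> \<Sum>\<^sub>v x\<^sub>v\<^sup>k + (1 - \<alpha>) k \<Prod>\<^sub>v x\<^sub>v)\<close> over the nonnegative \<open>x\<close> with
  \<open>\<Sum>\<^sub>v x\<^sub>v\<^sup>k = 1\<close>, and every maximiser is positive.  Let \<open>x\<close> be a maximiser for a supertree and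
  \<open>u\<close> a vertex where it is largest.  If an edge \<open>f\<close> misses \<open>u\<close>, exchanging the vertex of \<open>f\<close>
  closest to \<open>u\<close> for \<open>u\<close> gives a supertree of strictly larger radius.  If at least two edges miss
  \<open>u\<close>, the new supertree is still not a star; if exactly one does, the supertree already is
  \<open>S\<^sup>k(1, m - 2)\<close>.  So the latter is the only maximiser of the radius among the finitely many
  supertrees on the same vertices that have \<open>m\<close> edges and are not stars.
\<close>

section \<open>The tensor of a hypergraph\<close>

text \<open>A move changes the maximiser and possibly its largest vertex, so no chain of moves
  leading from \<open>T\<close> to the double star can be fixed in advance. Taking a maximum over a
  finite class avoids this: an extremal member admits no improving move, and that alone determines
  its shape. The double star itself is never shown to be a supertree, nor rebuilt on the vertices of
  \<open>T\<close>; its radius is that of the extremal member, carried over by an isomorphism. The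
  exchange yields a supertree because, once \<open>f\<close> is deleted, the vertices of
  \<open>f\<close> lie in different components, and \<open>u\<close> lies in the component of the
  closest vertex \<open>p\<close>. The new edge therefore joins exactly the components that
  \<open>f\<close> joined. The variational description also replaces spectral theory. Stationarity
  at a positive maximiser is the eigenvalue equation, and the entrywise moduli of any complex
  eigenvector are a test vector that bounds its eigenvalue.\<close>

lemma tensor_apply_A_tensor:
  assumes G: "uniform k G" and k: "k \<ge> 2" and v: "v \<in> verts G"
  shows "tensor_apply k (verts G) (A_tensor k \<alpha> G) x v =
    of_real (\<alpha> * real (vertex_degree G v)) * x v ^ (k - 1) +
    of_real (1 - \<alpha>) * (\<Sum>e | e \<in> edges G \<and> v \<in> e. \<Prod>w\<in>e - {v}. x w)"
proof -
  let ?V = "verts G" and ?E = "edges G"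
  define L where "L = {js. set js \<subseteq> ?V \<and> length js = k - 1}"
  define Ev where "Ev = {e. e \<in> ?E \<and> v \<in> e}"
  define c :: complex where "c = of_real ((1 - \<alpha>) / fact (k - 1))"
  have finV: "finite ?V" and sub: "\<And>e. e \<in> ?E \<Longrightarrow> e \<subseteq> ?V" and crd: "\<And>e. e \<in> ?E \<Longrightarrow> card e = k"
    using G by (auto simp: uniform_def)
  have finE: "finite ?E" by (rule finite_subset[of _ "Pow ?V"]) (use finV sub in auto)
  have fine: "finite e" if "e \<in> ?E" for e using finV sub[OF that] finite_subset by blast
  have finL: "finite L" using finite_lists_length_eq[OF finV] by (simp add: L_def)
  have rep: "v # js = replicate k v \<longleftrightarrow> js = replicate (k - 1) v" for js
    using k by (cases k) auto
  have deg: "(\<Sum>js\<in>L. of_real (\<alpha> * degree_tensor k G (v # js)) * prod_list (map x js))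
      = of_real (\<alpha> * real (vertex_degree G v)) * x v ^ (k - 1)"
  proof -
    have "(\<Sum>js\<in>L. of_real (\<alpha> * degree_tensor k G (v # js)) * prod_list (map x js))
      = (\<Sum>js\<in>L. if js = replicate (k - 1) v
            then of_real (\<alpha> * real (vertex_degree G v)) * x v ^ (k - 1) else 0)"
      by (rule sum.cong) (auto simp: degree_tensor_def rep prod_list_replicate)
    also have "\<dots> = of_real (\<alpha> * real (vertex_degree G v)) * x v ^ (k - 1)"
      using finL v by (subst sum.delta) (auto simp: L_def)
    finally show ?thesis .
  qed
  \<comment> \<open>An edge has \<open>k\<close> elements and \<open>v # js\<close> has
    \<open>k\<close> entries, so nothing repeats and \<open>js\<close> is an ordering of
    \<open>e - {v}\<close>. The (k - 1)! orderings per edge cancel the normalisation of the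
    adjacency tensor.\<close>
  have perms: "{js \<in> L. insert v (set js) \<in> ?E} = (\<Union>e\<in>Ev. permutations_of_set (e - {v}))"
  proof (intro equalityI subsetI)
    fix js assume "js \<in> {js \<in> L. insert v (set js) \<in> ?E}"
    then have js: "set js \<subseteq> ?V" "length js = k - 1" "insert v (set js) \<in> ?E"
      by (auto simp: L_def)
    have "card (insert v (set js)) = Suc (length js)" using crd[OF js(3)] js(2) k by simp
    then have "card (set js) = length js \<and> v \<notin> set js"
      using card_length[of js] by (auto simp: card_insert_if split: if_splits)
    then show "js \<in> (\<Union>e\<in>Ev. permutations_of_set (e - {v}))"
      using js by (auto simp: permutations_of_set_def Ev_def card_distinct
          intro!: bexI[of _ "insert v (set js)"])
  next
    fix js assume "js \<in> (\<Union>e\<in>Ev. permutations_of_set (e - {v}))"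
    then obtain e where e: "e \<in> ?E" "v \<in> e" "set js = e - {v}" "distinct js"
      by (auto simp: permutations_of_set_def Ev_def)
    have "length js = k - 1"
      using distinct_card[OF e(4)] e crd[OF e(1)] fine[OF e(1)] by simp
    then show "js \<in> {js \<in> L. insert v (set js) \<in> ?E}"
      using e sub[OF e(1)] by (auto simp: L_def insert_absorb)
  qed
  have adj: "(\<Sum>js\<in>L. of_real ((1 - \<alpha>) * adjacency_tensor k G (v # js)) * prod_list (map x js))
      = of_real (1 - \<alpha>) * (\<Sum>e\<in>Ev. \<Prod>w\<in>e - {v}. x w)"
  proof -
    have "(\<Sum>js\<in>L. of_real ((1 - \<alpha>) * adjacency_tensor k G (v # js)) * prod_list (map x js))
      = (\<Sum>js\<in>L. if insert v (set js) \<in> ?E then c * prod_list (map x js) else 0)"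
      using k by (intro sum.cong) (auto simp: adjacency_tensor_def L_def c_def)
    also have "\<dots> = (\<Sum>js\<in>{js \<in> L. insert v (set js) \<in> ?E}. c * prod_list (map x js))"
      using finL by (rule sum.inter_filter[symmetric])
    also have "\<dots> = (\<Sum>e\<in>Ev. \<Sum>js\<in>permutations_of_set (e - {v}). c * prod_list (map x js))"
      unfolding perms
    proof (rule sum.UNION_disjoint)
      show "finite Ev" using finE by (simp add: Ev_def)
      show "\<forall>e\<in>Ev. finite (permutations_of_set (e - {v}))" by simp
      show "\<forall>e\<in>Ev. \<forall>e'\<in>Ev. e \<noteq> e' \<longrightarrow>
          permutations_of_set (e - {v}) \<inter> permutations_of_set (e' - {v}) = {}"
        by (auto simp: Ev_def permutations_of_set_def)
    qed
    also have "\<dots> = (\<Sum>e\<in>Ev. of_real (1 - \<alpha>) * (\<Prod>w\<in>e - {v}. x w))"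
    proof (rule sum.cong[OF refl])
      fix e assume e: "e \<in> Ev"
      then have ce: "card (e - {v}) = k - 1" "finite (e - {v})"
        using crd fine by (auto simp: Ev_def)
      have "(\<Sum>js\<in>permutations_of_set (e - {v}). c * prod_list (map x js))
        = (\<Sum>js\<in>permutations_of_set (e - {v}). c * (\<Prod>w\<in>e - {v}. x w))"
        by (rule sum.cong) (auto simp: permutations_of_set_def prod.distinct_set_conv_list[symmetric])
      also have "\<dots> = fact (k - 1) * (c * (\<Prod>w\<in>e - {v}. x w))"
        using ce by simp
      also have "\<dots> = of_real (1 - \<alpha>) * (\<Prod>w\<in>e - {v}. x w)"
        by (simp add: c_def)
      finally show "(\<Sum>js\<in>permutations_of_set (e - {v}). c * prod_list (map x js))
        = of_real (1 - \<alpha>) * (\<Prod>w\<in>e - {v}. x w)" .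
    qed
    finally show ?thesis by (simp add: sum_distrib_left)
  qed
  have "tensor_apply k ?V (A_tensor k \<alpha> G) x v =
     (\<Sum>js\<in>L. of_real (\<alpha> * degree_tensor k G (v # js)) * prod_list (map x js)) +
     (\<Sum>js\<in>L. of_real ((1 - \<alpha>) * adjacency_tensor k G (v # js)) * prod_list (map x js))"
    by (simp add: tensor_apply_def A_tensor_def L_def sum.distrib[symmetric] ring_distribs)
  then show ?thesis unfolding deg adj Ev_def .
qed

section \<open>Invariance under isomorphism, across different vertex types\<close>

lemma isomorphic_sym:
  assumes "\<And>e. e \<in> edges G \<Longrightarrow> e \<subseteq> verts G" and "isomorphic G H"
  shows "isomorphic H G"
proof -
  obtain f where f: "bij_betw f (verts G) (verts H)" "edges H = (\<lambda>e. f ` e) ` edges G"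
    using assms(2) by (auto simp: isomorphic_def)
  let ?g = "inv_into (verts G) f"
  have "?g ` f ` e = e" if "e \<in> edges G" for e
    using assms(1)[OF that] f(1) by (simp add: bij_betw_def inv_into_image_cancel)
  then have "edges G = (\<lambda>e. ?g ` e) ` edges H" unfolding f(2) by (auto simp: image_iff)
  then show ?thesis using bij_betw_inv_into[OF f(1)] by (auto simp: isomorphic_def)
qed

lemma uniform_isomorphic:
  assumes G: "uniform k G" and iso: "isomorphic G H"
  shows "uniform k H"
proof -
  obtain f where f: "bij_betw f (verts G) (verts H)" "edges H = (\<lambda>e. f ` e) ` edges G"
    using iso by (auto simp: isomorphic_def)
  then have im: "f ` verts G = verts H" and inj: "inj_on f (verts G)" by (auto simp: bij_betw_def)
  have "card (f ` e) = k" if "e \<in> edges G" for e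
    using that G inj by (metis card_image inj_on_subset uniform_def)
  moreover have "f ` e \<subseteq> verts H" if "e \<in> edges G" for e
    using that G im by (auto simp: uniform_def)
  moreover have "finite (verts H)" using G by (simp add: uniform_def im[symmetric])
  ultimately show ?thesis by (auto simp: uniform_def f(2))
qed

text \<open>An eigenvector \<open>x\<close> of \<open>H\<close> pulls back to
  \<open>x \<circ> f\<close>: the bijection matches the edges at \<open>v\<close> with those at
  \<open>f v\<close>, so degrees and edge products agree.\<close>

lemma tensor_eigenvalue_isomorphic:
  assumes G: "uniform k G" and k: "k \<ge> 2" and iso: "isomorphic G H"
    and ev: "tensor_eigenvalue k (verts H) (A_tensor k \<alpha> H) \<mu>"
  shows "tensor_eigenvalue k (verts G) (A_tensor k \<alpha> G) \<mu>"
proof -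
  obtain f where f: "bij_betw f (verts G) (verts H)" "edges H = (\<lambda>e. f ` e) ` edges G"
    using iso by (auto simp: isomorphic_def)
  then have im: "f ` verts G = verts H" and inj: "inj_on f (verts G)" by (auto simp: bij_betw_def)
  have H: "uniform k H" using uniform_isomorphic[OF G iso] .
  have sub: "\<And>e. e \<in> edges G \<Longrightarrow> e \<subseteq> verts G" using G by (auto simp: uniform_def)
  obtain x where x: "\<exists>i\<in>verts H. x i \<noteq> 0"
    "\<And>i. i \<in> verts H \<Longrightarrow> tensor_apply k (verts H) (A_tensor k \<alpha> H) x i = \<mu> * x i ^ (k - 1)"
    using ev by (auto simp: tensor_eigenvalue_def)
  have "tensor_apply k (verts G) (A_tensor k \<alpha> G) (x \<circ> f) v = \<mu> * (x \<circ> f) v ^ (k - 1)"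
    if v: "v \<in> verts G" for v
  proof -
    have Ev: "{e. e \<in> edges H \<and> f v \<in> e} = (\<lambda>e. f ` e) ` {e. e \<in> edges G \<and> v \<in> e}"
      unfolding f(2) using inj_on_image_mem_iff[OF inj v] sub by blast
    have injE: "inj_on (\<lambda>e. f ` e) {e. e \<in> edges G \<and> v \<in> e}"
      using inj sub by (auto intro!: inj_onI simp: inj_on_image_eq_iff)
    have d: "vertex_degree H (f v) = vertex_degree G v"
      unfolding vertex_degree_def Ev by (rule card_image[OF injE])
    have "(\<Prod>w\<in>f ` e - {f v}. x w) = (\<Prod>w\<in>e - {v}. (x \<circ> f) w)" if "e \<in> edges G" "v \<in> e" for e
    proof -
      have "f ` e - {f v} = f ` (e - {v})"
        using inj_on_image_set_diff[OF inj, of e "{v}"] sub[OF that(1)] v by auto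
      moreover have "inj_on f (e - {v})" using inj sub[OF that(1)] by (auto intro: inj_on_subset)
      ultimately show ?thesis by (simp add: prod.reindex)
    qed
    then have "(\<Sum>e | e \<in> edges H \<and> f v \<in> e. \<Prod>w\<in>e - {f v}. x w)
       = (\<Sum>e | e \<in> edges G \<and> v \<in> e. \<Prod>w\<in>e - {v}. (x \<circ> f) w)"
      unfolding Ev by (subst sum.reindex[OF injE]) (auto intro: sum.cong)
    then have "tensor_apply k (verts G) (A_tensor k \<alpha> G) (x \<circ> f) v
        = tensor_apply k (verts H) (A_tensor k \<alpha> H) x (f v)"
      using v im by (subst tensor_apply_A_tensor[OF G k v], subst tensor_apply_A_tensor[OF H k])
        (auto simp: d)
    then show ?thesis using x(2) v im by auto
  qed
  moreover have "\<exists>i\<in>verts G. (x \<circ> f) i \<noteq> 0" using x(1) unfolding im[symmetric] by auto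
  ultimately show ?thesis unfolding tensor_eigenvalue_def by blast
qed

lemma alpha_spectral_radius_isomorphic:
  assumes G: "uniform k G" and k: "k \<ge> 2" and iso: "isomorphic G H"
  shows "alpha_spectral_radius k \<alpha> G = alpha_spectral_radius k \<alpha> H"
proof -
  have H: "uniform k H" using uniform_isomorphic[OF G iso] .
  have iso': "isomorphic H G" using G by (intro isomorphic_sym[OF _ iso]) (auto simp: uniform_def)
  have "tensor_eigenvalue k (verts G) (A_tensor k \<alpha> G) \<mu>
     \<longleftrightarrow> tensor_eigenvalue k (verts H) (A_tensor k \<alpha> H) \<mu>" for \<mu>
    using tensor_eigenvalue_isomorphic[OF G k iso] tensor_eigenvalue_isomorphic[OF H k iso'] by blast
  then show ?thesis by (simp add: alpha_spectral_radius_def)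
qed

section \<open>Variational characterisation of the spectral radius\<close>

text \<open>This is \<open>\<Sum>v. x v * (A x) v\<close> for the tensor \<open>A\<close> of the
  hypergraph, regrouped by edges (see \<open>tensor_form_eq_sum\<close>). An edge product arises
  once from each vertex of the edge, hence the factor \<open>k\<close>.\<close>

definition tensor_form :: "nat \<Rightarrow> real \<Rightarrow> 'a set set \<Rightarrow> ('a \<Rightarrow> real) \<Rightarrow> real" where
  "tensor_form k \<alpha> E x = (\<Sum>e\<in>E. \<alpha> * (\<Sum>v\<in>e. x v ^ k) + (1 - \<alpha>) * real k * (\<Prod>v\<in>e. x v))"

text \<open>The partial derivative of \<open>\<Sum>e\<in>E. \<Prod>w\<in>e. x w\<close> with respect
  to the entry at \<open>v\<close>.\<close>

definition nbr_sum :: "'a set set \<Rightarrow> ('a \<Rightarrow> real) \<Rightarrow> 'a \<Rightarrow> real" where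
  "nbr_sum E x v = (\<Sum>e | e \<in> E \<and> v \<in> e. \<Prod>w\<in>e - {v}. x w)"

lemma uniform_finite:
  assumes "uniform k G"
  shows "finite (verts G)" "finite (edges G)" "e \<in> edges G \<Longrightarrow> finite e"
    "e \<in> edges G \<Longrightarrow> e \<subseteq> verts G" "e \<in> edges G \<Longrightarrow> card e = k"
proof -
  show fin: "finite (verts G)" and sub: "e \<in> edges G \<Longrightarrow> e \<subseteq> verts G"
    and "e \<in> edges G \<Longrightarrow> card e = k" for e
    using assms by (auto simp: uniform_def)
  show "finite (edges G)" by (rule finite_subset[of _ "Pow (verts G)"]) (use fin sub in auto)
  show "e \<in> edges G \<Longrightarrow> finite e" using fin sub finite_subset by metis
qed

lemma tensor_form_cong:
  assumes "uniform k G" "\<And>v. v \<in> verts G \<Longrightarrow> x v = y v"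
  shows "tensor_form k \<alpha> (edges G) x = tensor_form k \<alpha> (edges G) y"
proof -
  have "x v = y v" if "e \<in> edges G" "v \<in> e" for e v
    using assms(2) uniform_finite(4)[OF assms(1) that(1)] that(2) by auto
  then show ?thesis unfolding tensor_form_def
    by (intro sum.cong refl arg_cong2[where f = "(+)"] arg_cong2[where f = "(*)"] prod.cong)
       (auto intro: sum.cong)
qed

lemma tensor_form_scale:
  assumes "uniform k G"
  shows "tensor_form k \<alpha> (edges G) (\<lambda>v. c * x v) = c ^ k * tensor_form k \<alpha> (edges G) x"
  unfolding tensor_form_def sum_distrib_left[of "c ^ k"]
proof (rule sum.cong[OF refl])
  fix e assume "e \<in> edges G"
  then have "(\<Prod>v\<in>e. c * x v) = c ^ k * (\<Prod>v\<in>e. x v)"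
    using uniform_finite(5)[OF assms] by (simp add: prod.distrib)
  moreover have "(\<Sum>v\<in>e. (c * x v) ^ k) = c ^ k * (\<Sum>v\<in>e. x v ^ k)"
    by (simp add: power_mult_distrib sum_distrib_left)
  ultimately show "\<alpha> * (\<Sum>v\<in>e. (c * x v) ^ k) + (1 - \<alpha>) * real k * (\<Prod>v\<in>e. c * x v)
     = c ^ k * (\<alpha> * (\<Sum>v\<in>e. x v ^ k) + (1 - \<alpha>) * real k * (\<Prod>v\<in>e. x v))"
    by (simp add: algebra_simps)
qed

text \<open>Both sides are homogeneous of degree \<open>k\<close>, so a maximum over the compact set
  of normalised vectors suffices. The bound for unnormalised \<open>y\<close> later allows single
  entries to be perturbed without rescaling.\<close>

lemma tensor_form_maximizer:
  assumes G: "uniform k G" and k: "k \<ge> 1" and ne: "verts G \<noteq> {}"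
  obtains x where "\<forall>v\<in>verts G. 0 \<le> x v" "(\<Sum>v\<in>verts G. x v ^ k) = 1"
    "\<forall>y. (\<forall>v\<in>verts G. 0 \<le> y v) \<longrightarrow>
       tensor_form k \<alpha> (edges G) y \<le> tensor_form k \<alpha> (edges G) x * (\<Sum>v\<in>verts G. y v ^ k)"
proof -
  let ?V = "verts G" and ?P = "tensor_form k \<alpha> (edges G)"
  have fin: "finite ?V" using uniform_finite[OF G] by auto
  \<comment> \<open>The vertex type may be infinite, so entries outside \<open>?V\<close> are pinned
    to 0 and compactness comes from the product topology. The bound 1 loses nothing, since
    normalised nonnegative vectors satisfy it (\<open>z1\<close> below).\<close>
  define B :: "('a \<Rightarrow> real) set" where "B = PiE UNIV (\<lambda>i. if i \<in> ?V then {0..1} else {0})"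
  define K where "K = B \<inter> {x. (\<Sum>v\<in>?V. x v ^ k) = 1}"
  have coord: "continuous_on S (\<lambda>x :: 'a \<Rightarrow> real. x i)" for i S
    by (rule continuous_on_subset[OF continuous_on_product_coordinates subset_UNIV])
  have "compactin (product_topology (\<lambda>i. euclidean) UNIV) B"
    unfolding B_def by (subst compactin_PiE) auto
  then have "compact B" by (simp add: euclidean_product_topology)
  moreover have "closed {x. (\<Sum>v\<in>?V. x v ^ k) = (1::real)}"
    by (intro closed_Collect_eq continuous_intros coord)
  ultimately have cK: "compact K" by (simp add: K_def compact_Int_closed)
  obtain v0 where v0: "v0 \<in> ?V" using ne by auto
  have "(\<Sum>v\<in>?V. (if v = v0 then 1 else 0 :: real) ^ k) = (\<Sum>v\<in>?V. if v = v0 then 1 else 0)"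
    using k by (intro sum.cong) auto
  then have "(\<lambda>v. if v = v0 then 1 else 0) \<in> K"
    using v0 fin by (auto simp: K_def B_def)
  then have neK: "K \<noteq> {}" by auto
  have "continuous_on K ?P"
    unfolding tensor_form_def by (intro continuous_intros coord)
  from continuous_attains_sup[OF cK neK this] obtain x where x: "x \<in> K"
    and max: "\<And>y. y \<in> K \<Longrightarrow> ?P y \<le> ?P x" by auto
  show ?thesis
  proof (rule that[of x], intro ballI)
    fix v assume v: "v \<in> ?V"
    have "x v \<in> (if v \<in> ?V then {0..1} else {0})"
      using x unfolding K_def B_def by (intro PiE_mem[of x UNIV]) auto
    then show "0 \<le> x v" using v by simp
  next
    show "(\<Sum>v\<in>?V. x v ^ k) = 1" using x by (auto simp: K_def)
  next
    have "?P y \<le> ?P x * (\<Sum>v\<in>?V. y v ^ k)" if y: "\<And>v. v \<in> ?V \<Longrightarrow> 0 \<le> y v" for y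
    proof -
      define s where "s = (\<Sum>v\<in>?V. y v ^ k)"
      have s0: "s \<ge> 0" unfolding s_def by (intro sum_nonneg) (use y in auto)
      show ?thesis
      proof (cases "s = 0")
        case True
        then have "\<forall>v\<in>?V. y v ^ k = 0"
          using y fin unfolding s_def by (subst (asm) sum_nonneg_eq_0_iff) auto
        then have "?P y = ?P (\<lambda>v. 0 * y v)"
          using k by (intro tensor_form_cong[OF G]) auto
        also have "\<dots> = 0" using k unfolding tensor_form_scale[OF G] by simp
        finally show ?thesis using True by (simp add: s_def)
      next
        case False
        then have s: "s > 0" using s0 by simp
        define r where "r = root k s"
        have r: "r > 0" "r ^ k = s" using s k by (auto simp: r_def)
        define z where "z = (\<lambda>v. if v \<in> ?V then 1 / r * y v else 0)"
        have "(\<Sum>v\<in>?V. z v ^ k) = (\<Sum>v\<in>?V. y v ^ k / s)"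
          by (intro sum.cong) (auto simp: z_def power_mult_distrib power_divide r)
        also have "\<dots> = 1" using s by (simp add: s_def sum_divide_distrib[symmetric])
        finally have sz: "(\<Sum>v\<in>?V. z v ^ k) = 1" .
        have z0: "0 \<le> z v" for v using y r by (auto simp: z_def)
        have z1: "z v \<le> 1" if "v \<in> ?V" for v
        proof -
          have "z v ^ k \<le> (\<Sum>v\<in>?V. z v ^ k)"
            using fin that z0 by (intro member_le_sum) auto
          then show ?thesis using sz z0 k by (metis power_le_one_iff not_one_le_zero)
        qed
        have zB: "z i \<in> (if i \<in> ?V then {0..1} else {0})" for i
          using z0[of i] z1[of i] by (cases "i \<in> ?V") (simp_all add: z_def)
        have "z \<in> K" unfolding K_def B_def using sz zB by (intro IntI PiE_I) auto
        from max[OF this] have "?P z \<le> ?P x" .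
        moreover have "?P z = ?P (\<lambda>v. 1 / r * y v)"
          by (intro tensor_form_cong[OF G]) (auto simp: z_def)
        ultimately have "(1 / r) ^ k * ?P y \<le> ?P x" by (simp only: tensor_form_scale[OF G])
        then show ?thesis using s r by (simp add: power_divide s_def[symmetric] field_simps)
      qed
    qed
    then show "\<forall>y. (\<forall>v\<in>?V. 0 \<le> y v) \<longrightarrow> ?P y \<le> ?P x * (\<Sum>v\<in>?V. y v ^ k)" by simp
  qed
qed

text \<open>A vertex occurs at most once in an edge, so edge products are affine in the entry at
  \<open>v\<close>. What remains is a polynomial in one variable that can be differentiated.\<close>

lemma tensor_form_update:
  assumes G: "uniform k G" and k: "k \<ge> 1"
  obtains C where "\<And>s. tensor_form k \<alpha> (edges G) (x(v := s)) =
    \<alpha> * real (vertex_degree G v) * s ^ k + (1 - \<alpha>) * real k * nbr_sum (edges G) x v * s + C"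
proof -
  let ?E = "edges G"
  let ?W = "\<lambda>e y. \<alpha> * (\<Sum>v\<in>e. y v ^ k) + (1 - \<alpha>) * real k * (\<Prod>v\<in>e. y v)"
  define Ev where "Ev = {e. e \<in> ?E \<and> v \<in> e}"
  define C where "C = (\<Sum>e\<in>?E - Ev. ?W e x) + (\<Sum>e\<in>Ev. \<alpha> * (\<Sum>w\<in>e - {v}. x w ^ k))"
  note fin = uniform_finite[OF G]
  have fEv: "finite Ev" using fin(2) by (simp add: Ev_def)
  have "tensor_form k \<alpha> ?E (x(v := s)) =
    \<alpha> * real (vertex_degree G v) * s ^ k + (1 - \<alpha>) * real k * nbr_sum ?E x v * s + C" for s
  proof -
    have 1: "?W e (x(v := s)) = ?W e x" if "e \<in> ?E - Ev" for e
    proof -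
      have "w \<noteq> v" if "w \<in> e" for w using that \<open>e \<in> ?E - Ev\<close> by (auto simp: Ev_def)
      then show ?thesis by simp
    qed
    have 2: "?W e (x(v := s)) = \<alpha> * s ^ k + (1 - \<alpha>) * real k * (\<Prod>w\<in>e - {v}. x w) * s
        + \<alpha> * (\<Sum>w\<in>e - {v}. x w ^ k)" if "e \<in> Ev" for e
    proof -
      have e: "finite e" "v \<in> e" using that fin(3) by (auto simp: Ev_def)
      have "(\<Sum>w\<in>e. (x(v := s)) w ^ k) = s ^ k + (\<Sum>w\<in>e - {v}. x w ^ k)"
        using e by (subst sum.remove[of e v]) auto
      moreover have "(\<Prod>w\<in>e. (x(v := s)) w) = s * (\<Prod>w\<in>e - {v}. x w)"
        using e by (subst prod.remove[of e v]) auto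
      ultimately show ?thesis by (simp add: algebra_simps)
    qed
    have "tensor_form k \<alpha> ?E (x(v := s)) = (\<Sum>e\<in>?E - Ev. ?W e (x(v := s))) + (\<Sum>e\<in>Ev. ?W e (x(v := s)))"
      unfolding tensor_form_def using fin(2) by (intro sum.subset_diff) (auto simp: Ev_def)
    also have "\<dots> = (\<Sum>e\<in>?E - Ev. ?W e x) + (\<Sum>e\<in>Ev. \<alpha> * s ^ k + (1 - \<alpha>) * real k * (\<Prod>w\<in>e - {v}. x w) * s
        + \<alpha> * (\<Sum>w\<in>e - {v}. x w ^ k))"
      by (intro arg_cong2[where f = "(+)"] sum.cong refl 1 2)
    also have "\<dots> = \<alpha> * real (card Ev) * s ^ k + (1 - \<alpha>) * real k * (\<Sum>e\<in>Ev. \<Prod>w\<in>e - {v}. x w) * s + C"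
      by (simp only: C_def sum.distrib sum_distrib_left sum_distrib_right sum_constant) (simp add: mult_ac)
    finally show ?thesis by (simp add: Ev_def vertex_degree_def nbr_sum_def)
  qed
  then show ?thesis by (rule that)
qed

text \<open>In place of Lagrange multipliers, only the entry at \<open>v\<close> varies. The gap
  between the two sides of \<open>le\<close> is nonnegative and vanishes at \<open>x\<close>, so its
  derivative there is zero; that is the claim multiplied by \<open>k\<close>.\<close>

lemma tensor_form_stationary:
  assumes G: "uniform k G" and k: "k \<ge> 1" and v: "v \<in> verts G"
    and pos: "\<And>v. v \<in> verts G \<Longrightarrow> 0 < x v"
    and eq: "tensor_form k \<alpha> (edges G) x = R * (\<Sum>v\<in>verts G. x v ^ k)"
    and le: "\<And>y. (\<And>v. v \<in> verts G \<Longrightarrow> 0 \<le> y v) \<Longrightarrow>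
       tensor_form k \<alpha> (edges G) y \<le> R * (\<Sum>v\<in>verts G. y v ^ k)"
  shows "\<alpha> * real (vertex_degree G v) * x v ^ (k - 1) + (1 - \<alpha>) * nbr_sum (edges G) x v
    = R * x v ^ (k - 1)"
proof -
  define a where "a = \<alpha> * real (vertex_degree G v)"
  define b where "b = (1 - \<alpha>) * nbr_sum (edges G) x v"
  define D where "D = (\<Sum>w\<in>verts G - {v}. x w ^ k)"
  note fin = uniform_finite[OF G]
  obtain C where C: "\<And>s. tensor_form k \<alpha> (edges G) (x(v := s)) = a * s ^ k + real k * b * s + C"
    using tensor_form_update[OF G k, of \<alpha> x v] by (auto simp: a_def b_def algebra_simps)
  have S: "(\<Sum>w\<in>verts G. (x(v := s)) w ^ k) = s ^ k + D" for s
    using fin(1) v by (subst sum.remove[of _ v]) (auto simp: D_def)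
  define g where "g = (\<lambda>s. R * (s ^ k + D) - (a * s ^ k + real k * b * s + C))"
  have g0: "g (x v) = 0"
    using eq C[of "x v"] S[of "x v"] by (simp add: g_def)
  have gn: "0 \<le> g s" if "s \<ge> 0" for s
  proof -
    have "tensor_form k \<alpha> (edges G) (x(v := s)) \<le> R * (\<Sum>w\<in>verts G. (x(v := s)) w ^ k)"
      using that pos by (intro le) (auto simp: less_imp_le)
    then show ?thesis unfolding C S g_def by simp
  qed
  have "(g has_real_derivative (R * (real k * x v ^ (k - 1)) - (a * (real k * x v ^ (k - 1)) + real k * b))) (at (x v))"
    unfolding g_def by (auto intro!: derivative_eq_intros)
  then have "R * (real k * x v ^ (k - 1)) - (a * (real k * x v ^ (k - 1)) + real k * b) = 0"
  proof (rule DERIV_local_min)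
    \<comment> \<open>A neighbourhood of radius \<open>x v\<close> contains positive entries only,
      which is where \<open>gn\<close> is available.\<close>
    show "0 < x v" using pos v by auto
    show "\<forall>y. \<bar>x v - y\<bar> < x v \<longrightarrow> g (x v) \<le> g y" using g0 gn by auto
  qed
  then have "real k * (R * x v ^ (k - 1) - (a * x v ^ (k - 1) + b)) = 0" by (simp add: algebra_simps)
  then show ?thesis using k by (simp add: a_def b_def)
qed

text \<open>It depends on the edges alone, so that reachability after deleting or exchanging an edge
  is the closure of \<open>hadj\<close> for another edge set.\<close>

definition hadj :: "'a set set \<Rightarrow> ('a \<times> 'a) set" where
  "hadj E = {(x, y). \<exists>e\<in>E. x \<in> e \<and> y \<in> e}"

lemma hconnected_iff:
  "hconnected G \<longleftrightarrow> verts G \<noteq> {} \<and> (\<forall>u\<in>verts G. \<forall>v\<in>verts G. (u, v) \<in> (hadj (edges G))\<^sup>*)"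
  unfolding hconnected_def hadj_def by (rule refl)

lemma hadj_boundary_edge:
  assumes "(b, v) \<in> (hadj E)\<^sup>*" "b \<notin> Z" "v \<in> Z"
  obtains e p q where "e \<in> E" "p \<in> e" "p \<notin> Z" "q \<in> e" "q \<in> Z"
proof -
  have "\<exists>e\<in>E. \<exists>p\<in>e. \<exists>q\<in>e. p \<notin> Z \<and> q \<in> Z"
    using assms
  proof (induction rule: rtrancl_induct)
    case (step y z)
    then show ?case by (cases "y \<in> Z") (auto simp: hadj_def)
  qed simp
  then show ?thesis using that by blast
qed

text \<open>
  If a maximiser vanished on part of an edge, say on \<open>j < k\<close> of its vertices, raising those
  entries to \<open>t\<close> would gain a term of order \<open>t\<^sup>j\<close> at a cost of order \<open>t\<^sup>k\<close> only.
\<close>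

lemma tensor_form_maximizer_pos:
  assumes G: "uniform k G" and k: "k \<ge> 2" and \<alpha>: "0 \<le> \<alpha>" "\<alpha> < 1" and conn: "hconnected G"
    and x0: "\<And>v. v \<in> verts G \<Longrightarrow> 0 \<le> x v" and x1: "(\<Sum>v\<in>verts G. x v ^ k) = 1"
    and eq: "tensor_form k \<alpha> (edges G) x = R"
    and le: "\<And>y. (\<And>v. v \<in> verts G \<Longrightarrow> 0 \<le> y v) \<Longrightarrow>
       tensor_form k \<alpha> (edges G) y \<le> R * (\<Sum>v\<in>verts G. y v ^ k)"
    and v: "v \<in> verts G"
  shows "0 < x v"
proof (rule ccontr)
  let ?V = "verts G" and ?E = "edges G"
  let ?W = "\<lambda>e y. \<alpha> * (\<Sum>v\<in>e. y v ^ k) + (1 - \<alpha>) * real k * (\<Prod>v\<in>e. y v)"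
  note fin = uniform_finite[OF G]
  define Z where "Z = {v \<in> ?V. x v = 0}"
  assume "\<not> 0 < x v"
  then have vZ: "v \<in> Z" using x0[OF v] v by (auto simp: Z_def)
  have "\<exists>b\<in>?V. x b \<noteq> 0"
  proof (rule ccontr)
    assume "\<not> ?thesis"
    then have "(\<Sum>v\<in>?V. x v ^ k) = 0" using k by (intro sum.neutral) auto
    then show False using x1 by simp
  qed
  then obtain b where b: "b \<in> ?V" "b \<notin> Z" by (auto simp: Z_def)
  have "(b, v) \<in> (hadj ?E)\<^sup>*" using conn b v by (auto simp: hconnected_iff)
  then obtain e p q where e: "e \<in> ?E" and p: "p \<in> e" "p \<notin> Z" and q: "q \<in> e" "q \<in> Z"
    using hadj_boundary_edge b vZ by metis
  have fe: "finite e" "e \<subseteq> ?V" "card e = k" using fin e by auto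
  define S where "S = e \<inter> Z"
  define j where "j = card S"
  define C where "C = (\<Prod>w\<in>e - S. x w)"
  have S: "S \<subseteq> e" "finite S" "S \<subseteq> ?V" and xS: "\<And>w. w \<in> S \<Longrightarrow> x w = 0"
    using fe by (auto simp: S_def Z_def)
  have "j < k" unfolding j_def fe(3)[symmetric] S_def using p fe by (intro psubset_card_mono) auto
  have C: "C > 0" unfolding C_def
  proof (rule prod_pos)
    fix w assume "w \<in> e - S"
    then show "0 < x w" using x0[of w] fe(2) by (fastforce simp: S_def Z_def)
  qed
  define c where "c = (1 - \<alpha>) * real k * C"
  \<comment> \<open>The sign of \<open>R\<close> is not known at this point, hence the absolute
    value.\<close>
  define M where "M = \<bar>R\<bar> * real j"
  have c: "c > 0" using C \<alpha> k by (simp add: c_def)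
  have bound: "c * t ^ j \<le> R * real j * t ^ k" if t: "t > 0" for t
  proof -
    define y where "y = (\<lambda>w. if w \<in> S then t else x w)"
    have y0: "0 \<le> y w" if "w \<in> ?V" for w using x0[OF that] t by (auto simp: y_def)
    have xy: "x w \<le> y w" for w using t xS by (auto simp: y_def)
    have "(\<Sum>w\<in>?V. y w ^ k) = (\<Sum>w\<in>?V. x w ^ k + (if w \<in> S then t ^ k else 0))"
      using xS k by (intro sum.cong) (auto simp: y_def)
    also have "\<dots> = 1 + real j * t ^ k"
      using S fin(1) x1 by (simp add: sum.distrib sum.If_cases j_def Int_absorb1)
    finally have sy: "(\<Sum>w\<in>?V. y w ^ k) = 1 + real j * t ^ k" .
    have mono: "?W e' x \<le> ?W e' y" if "e' \<in> ?E" for e'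
    proof -
      have sub: "\<And>w. w \<in> e' \<Longrightarrow> 0 \<le> x w" using x0 fin(4)[OF that] by auto
      have "(\<Sum>w\<in>e'. x w ^ k) \<le> (\<Sum>w\<in>e'. y w ^ k)"
        using sub xy by (intro sum_mono power_mono) auto
      moreover have "(\<Prod>w\<in>e'. x w) \<le> (\<Prod>w\<in>e'. y w)"
        using sub xy by (intro prod_mono) auto
      ultimately show ?thesis using \<alpha> by (intro add_mono mult_left_mono) auto
    qed
    have "(\<Prod>w\<in>e. y w) = (\<Prod>w\<in>e - S. y w) * (\<Prod>w\<in>S. y w)"
      using S fe by (intro prod.subset_diff) auto
    also have "\<dots> = C * t ^ j" by (simp add: y_def C_def j_def)
    finally have py: "(\<Prod>w\<in>e. y w) = C * t ^ j" .
    \<comment> \<open>The zero at \<open>q\<close> kills this edge product, so raising the entries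
      on \<open>S\<close> gains the whole of \<open>C * t ^ j\<close> in it.\<close>
    have px: "(\<Prod>w\<in>e. x w) = 0" using q fe by (auto simp: Z_def)
    have "(\<Sum>w\<in>e. x w ^ k) \<le> (\<Sum>w\<in>e. y w ^ k)"
      using x0 fe xy by (intro sum_mono power_mono) auto
    then have "?W e x + c * t ^ j \<le> ?W e y"
      unfolding py px c_def using \<alpha> by (simp add: mult_left_mono mult_ac)
    moreover have "(\<Sum>e'\<in>?E - {e}. ?W e' x) \<le> (\<Sum>e'\<in>?E - {e}. ?W e' y)"
      using mono by (intro sum_mono) auto
    moreover have "tensor_form k \<alpha> ?E z = ?W e z + (\<Sum>e'\<in>?E - {e}. ?W e' z)" for z
      unfolding tensor_form_def using fin(2) e by (rule sum.remove)
    ultimately have "R + c * t ^ j \<le> tensor_form k \<alpha> ?E y" using eq by simp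
    also have "\<dots> \<le> R * (1 + real j * t ^ k)" using le[of y] y0 sy by simp
    finally show ?thesis by (simp add: algebra_simps)
  qed
  \<comment> \<open>Chosen so that \<open>M * t < c\<close> and \<open>t \<le> 1\<close>. Since
    \<open>j < k\<close>, the cost is at most \<open>M * t * t ^ j\<close>, below the gain
    \<open>c * t ^ j\<close>.\<close>
  define t where "t = c / (c + M + 1)"
  have M: "M \<ge> 0" by (simp add: M_def)
  have t: "0 < t" "t \<le> 1" using c M by (auto simp: t_def)
  have "c * t ^ j \<le> R * real j * t ^ k" using bound t by auto
  also have "\<dots> \<le> M * t ^ k" using t by (intro mult_right_mono) (auto simp: M_def mult_right_mono)
  also have "\<dots> \<le> M * t ^ Suc j" using t M \<open>j < k\<close> by (intro mult_left_mono power_decreasing) auto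
  finally have "c * t ^ j \<le> (M * t) * t ^ j" by (simp add: mult_ac)
  then have "c \<le> M * t" using t by simp
  then have "c * (c + M + 1) \<le> M * c" using c M by (simp add: t_def field_simps)
  then show False using c M by (simp add: algebra_simps) (smt (verit) mult_pos_pos)
qed

text \<open>Double counting of the incident pairs of a vertex and an edge.\<close>

lemma tensor_form_eq_sum:
  assumes G: "uniform k G"
  shows "tensor_form k \<alpha> (edges G) y =
    (\<Sum>v\<in>verts G. y v * (\<alpha> * real (vertex_degree G v) * y v ^ (k - 1) + (1 - \<alpha>) * nbr_sum (edges G) y v))"
proof -
  let ?V = "verts G" and ?E = "edges G"
  note fin = uniform_finite[OF G]
  \<comment> \<open>For \<open>k = 0\<close> the truncated exponent would spoil this, but an edge
    that contains a vertex excludes that case. A vertex on no edge has degree 0 and contributes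
    nothing.\<close>
  have k: "y v * y v ^ (k - 1) = y v ^ k" if "e \<in> ?E" "v \<in> e" for e v
  proof -
    have "k \<noteq> 0" using fin(3)[OF that(1)] fin(5)[OF that(1)] that(2) by (metis card_0_eq empty_iff)
    then show ?thesis by (cases k) auto
  qed
  have Vr: "{v \<in> ?V. v \<in> e} = e" if "e \<in> ?E" for e using fin(4)[OF that] by auto
  have "(\<Sum>v\<in>?V. y v * (real (vertex_degree G v) * y v ^ (k - 1)))
      = (\<Sum>v\<in>?V. \<Sum>e\<in>{e \<in> ?E. v \<in> e}. y v ^ k)"
    using k by (intro sum.cong refl) (auto simp: vertex_degree_def card_eq_0_iff)
  also have "\<dots> = (\<Sum>e\<in>?E. \<Sum>v\<in>{v \<in> ?V. v \<in> e}. y v ^ k)"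
    using fin by (intro sum.swap_restrict) auto
  also have "\<dots> = (\<Sum>e\<in>?E. \<Sum>v\<in>e. y v ^ k)" using Vr by (intro sum.cong) auto
  finally have 1: "(\<Sum>v\<in>?V. y v * (real (vertex_degree G v) * y v ^ (k - 1)))
      = (\<Sum>e\<in>?E. \<Sum>v\<in>e. y v ^ k)" .
  have "(\<Sum>v\<in>?V. y v * nbr_sum ?E y v) = (\<Sum>v\<in>?V. \<Sum>e\<in>{e \<in> ?E. v \<in> e}. \<Prod>w\<in>e. y w)"
  proof (rule sum.cong[OF refl])
    fix v
    show "y v * nbr_sum ?E y v = (\<Sum>e\<in>{e \<in> ?E. v \<in> e}. \<Prod>w\<in>e. y w)"
      unfolding nbr_sum_def sum_distrib_left using fin(3)
      by (intro sum.cong refl) (auto simp: prod.remove)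
  qed
  also have "\<dots> = (\<Sum>e\<in>?E. \<Sum>v\<in>{v \<in> ?V. v \<in> e}. \<Prod>w\<in>e. y w)"
    using fin by (intro sum.swap_restrict) auto
  also have "\<dots> = (\<Sum>e\<in>?E. real k * (\<Prod>w\<in>e. y w))"
    using Vr fin(5) by (intro sum.cong) auto
  finally have 2: "(\<Sum>v\<in>?V. y v * nbr_sum ?E y v) = (\<Sum>e\<in>?E. real k * (\<Prod>w\<in>e. y w))" .
  have "(\<Sum>v\<in>?V. y v * (\<alpha> * real (vertex_degree G v) * y v ^ (k - 1) + (1 - \<alpha>) * nbr_sum ?E y v))
     = \<alpha> * (\<Sum>v\<in>?V. y v * (real (vertex_degree G v) * y v ^ (k - 1)))
      + (1 - \<alpha>) * (\<Sum>v\<in>?V. y v * nbr_sum ?E y v)"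
    unfolding sum_distrib_left sum.distrib[symmetric] by (rule sum.cong[OF refl]) (simp add: algebra_simps)
  also have "\<dots> = tensor_form k \<alpha> ?E y"
    unfolding 1 2 tensor_form_def sum_distrib_left[of _ _ ?E] sum.distrib[symmetric] by (simp add: mult.assoc)
  finally show ?thesis ..
qed

text \<open>The maximum \<open>R\<close> is itself an eigenvalue by stationarity, so the
  \<open>GREATEST\<close> in the definition is attained. No modulus exceeds it: the triangle
  inequality at each vertex, weighted by \<open>cmod (z v)\<close> and summed, bounds
  \<open>r\<close> by the form at the moduli of \<open>z\<close>.\<close>

lemma alpha_spectral_radius_variational:
  assumes G: "uniform k G" and k: "k \<ge> 2" and \<alpha>: "0 \<le> \<alpha>" "\<alpha> < 1" and conn: "hconnected G"
  obtains x where "\<forall>v\<in>verts G. 0 < x v" "(\<Sum>v\<in>verts G. x v ^ k) = 1"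
    "tensor_form k \<alpha> (edges G) x = alpha_spectral_radius k \<alpha> G"
    "\<forall>y. (\<forall>v\<in>verts G. 0 \<le> y v) \<longrightarrow>
       tensor_form k \<alpha> (edges G) y \<le> alpha_spectral_radius k \<alpha> G * (\<Sum>v\<in>verts G. y v ^ k)"
proof -
  let ?V = "verts G" and ?E = "edges G" and ?P = "tensor_form k \<alpha> (edges G)"
  note fin = uniform_finite[OF G]
  have k1: "k \<ge> 1" and ne: "?V \<noteq> {}" using k conn by (auto simp: hconnected_def)
  obtain x where "\<forall>v\<in>?V. 0 \<le> x v" and x1: "(\<Sum>v\<in>?V. x v ^ k) = 1"
    and max: "\<forall>y. (\<forall>v\<in>?V. 0 \<le> y v) \<longrightarrow> ?P y \<le> ?P x * (\<Sum>v\<in>?V. y v ^ k)"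
    by (rule tensor_form_maximizer[OF G k1 ne])
  then have x0: "\<And>v. v \<in> ?V \<Longrightarrow> 0 \<le> x v" by blast
  define R where "R = ?P x"
  then have xR: "?P x = R" by simp
  have le: "?P y \<le> R * (\<Sum>v\<in>?V. y v ^ k)" if "\<And>v. v \<in> ?V \<Longrightarrow> 0 \<le> y v" for y
    using max that by (simp add: R_def)
  have pos: "\<And>v. v \<in> ?V \<Longrightarrow> 0 < x v"
    by (rule tensor_form_maximizer_pos[OF G k \<alpha> conn x0 x1 xR le])
  \<comment> \<open>Needed for \<open>R = cmod (of_real R)\<close>.\<close>
  have R0: "0 \<le> R"
  proof -
    have "\<And>e v. e \<in> ?E \<Longrightarrow> v \<in> e \<Longrightarrow> 0 \<le> x v" using x0 fin(4) by blast
    then show ?thesis unfolding xR[symmetric] tensor_form_def using \<alpha>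
      by (intro sum_nonneg add_nonneg_nonneg mult_nonneg_nonneg prod_nonneg) auto
  qed
  have "alpha_spectral_radius k \<alpha> G = R"
    unfolding alpha_spectral_radius_def
  proof (rule Greatest_equality)
    have "tensor_apply k ?V (A_tensor k \<alpha> G) (\<lambda>v. of_real (x v)) v = of_real R * of_real (x v) ^ (k - 1)"
      if v: "v \<in> ?V" for v
    proof -
      have "\<alpha> * real (vertex_degree G v) * x v ^ (k - 1) + (1 - \<alpha>) * nbr_sum ?E x v = R * x v ^ (k - 1)"
        by (rule tensor_form_stationary[OF G k1 v pos _ le]) (simp_all add: xR x1)
      then have "complex_of_real (\<alpha> * real (vertex_degree G v) * x v ^ (k - 1) + (1 - \<alpha>) * nbr_sum ?E x v)
        = complex_of_real (R * x v ^ (k - 1))" by simp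
      then show ?thesis
        by (simp add: tensor_apply_A_tensor[OF G k v] nbr_sum_def)
    qed
    moreover have "\<exists>v\<in>?V. complex_of_real (x v) \<noteq> 0" using ne pos by fastforce
    ultimately have "tensor_eigenvalue k ?V (A_tensor k \<alpha> G) (of_real R)"
      unfolding tensor_eigenvalue_def
      by (intro exI[of _ "\<lambda>v. complex_of_real (x v)"] conjI ballI)
    then show "\<exists>\<mu>. tensor_eigenvalue k ?V (A_tensor k \<alpha> G) \<mu> \<and> R = cmod \<mu>"
      using R0 by (intro exI[of _ "of_real R"]) auto
  next
    fix r assume "\<exists>\<mu>. tensor_eigenvalue k ?V (A_tensor k \<alpha> G) \<mu> \<and> r = cmod \<mu>"
    then obtain \<mu> z where r: "r = cmod \<mu>" and z: "\<exists>i\<in>?V. z i \<noteq> 0"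
      and ev: "\<And>i. i \<in> ?V \<Longrightarrow> tensor_apply k ?V (A_tensor k \<alpha> G) z i = \<mu> * z i ^ (k - 1)"
      by (auto simp: tensor_eigenvalue_def)
    define y where "y = (\<lambda>v. cmod (z v))"
    have le1: "r * y v ^ (k - 1) \<le> \<alpha> * real (vertex_degree G v) * y v ^ (k - 1) + (1 - \<alpha>) * nbr_sum ?E y v"
      if v: "v \<in> ?V" for v
    proof -
      have "r * y v ^ (k - 1) = cmod (\<mu> * z v ^ (k - 1))"
        by (simp add: r y_def norm_mult norm_power)
      also have "\<dots> = cmod (of_real (\<alpha> * real (vertex_degree G v)) * z v ^ (k - 1) +
          of_real (1 - \<alpha>) * (\<Sum>e | e \<in> edges G \<and> v \<in> e. \<Prod>w\<in>e - {v}. z w))"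
        unfolding ev[OF v, symmetric] tensor_apply_A_tensor[OF G k v] ..
      also have "\<dots> \<le> cmod (of_real (\<alpha> * real (vertex_degree G v)) * z v ^ (k - 1)) +
          cmod (of_real (1 - \<alpha>) * (\<Sum>e | e \<in> edges G \<and> v \<in> e. \<Prod>w\<in>e - {v}. z w))"
        by (rule norm_triangle_ineq)
      also have "cmod (of_real (\<alpha> * real (vertex_degree G v)) * z v ^ (k - 1))
         = \<alpha> * real (vertex_degree G v) * y v ^ (k - 1)"
        using \<alpha> by (simp add: norm_mult norm_power y_def del: of_real_mult)
      also have "cmod (of_real (1 - \<alpha>) * (\<Sum>e | e \<in> edges G \<and> v \<in> e. \<Prod>w\<in>e - {v}. z w))
        = (1 - \<alpha>) * cmod (\<Sum>e | e \<in> edges G \<and> v \<in> e. \<Prod>w\<in>e - {v}. z w)"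
        using \<alpha> by (simp add: norm_mult del: of_real_diff)
      also have "\<dots> \<le> (1 - \<alpha>) * nbr_sum ?E y v"
        unfolding nbr_sum_def y_def prod_norm using \<alpha> by (intro mult_left_mono norm_sum) auto
      finally show ?thesis by simp
    qed
    have "r * (\<Sum>v\<in>?V. y v ^ k) = (\<Sum>v\<in>?V. y v * (r * y v ^ (k - 1)))"
      unfolding sum_distrib_left using k by (intro sum.cong) (auto simp: power_eq_if)
    also have "\<dots> \<le> ?P y"
      unfolding tensor_form_eq_sum[OF G] using le1
      by (intro sum_mono mult_left_mono) (auto simp: y_def)
    also have "\<dots> \<le> R * (\<Sum>v\<in>?V. y v ^ k)" by (rule le) (simp add: y_def)
    finally have "r * (\<Sum>v\<in>?V. y v ^ k) \<le> R * (\<Sum>v\<in>?V. y v ^ k)" .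
    moreover have "0 < (\<Sum>v\<in>?V. y v ^ k)"
      using z fin(1) by (auto simp: y_def intro!: sum_pos2)
    ultimately show "r \<le> R" by simp
  qed
  then show ?thesis using that[of x] pos x1 xR max by simp
qed

text \<open>Stated for every positive vector attaining equality, because
  \<open>edge_move_increases_radius\<close> applies it to the modified hypergraph with the maximiser
  of the original one.\<close>

lemma alpha_spectral_radius_eigenvector:
  assumes G: "uniform k G" and k: "k \<ge> 2" and \<alpha>: "0 \<le> \<alpha>" "\<alpha> < 1" and conn: "hconnected G"
    and "v \<in> verts G" and "\<And>v. v \<in> verts G \<Longrightarrow> 0 < x v"
    and "tensor_form k \<alpha> (edges G) x = alpha_spectral_radius k \<alpha> G * (\<Sum>v\<in>verts G. x v ^ k)"
  shows "\<alpha> * real (vertex_degree G v) * x v ^ (k - 1) + (1 - \<alpha>) * nbr_sum (edges G) x v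
    = alpha_spectral_radius k \<alpha> G * x v ^ (k - 1)"
proof -
  have "\<forall>y. (\<forall>v\<in>verts G. 0 \<le> y v) \<longrightarrow>
       tensor_form k \<alpha> (edges G) y \<le> alpha_spectral_radius k \<alpha> G * (\<Sum>v\<in>verts G. y v ^ k)"
    using alpha_spectral_radius_variational[OF G k \<alpha> conn] by blast
  then show ?thesis using assms by (intro tensor_form_stationary[OF G]) auto
qed

text \<open>
  Equality of the radii would make \<open>x\<close> an eigenvector of both hypergraphs for the same
  eigenvalue, but at \<open>u\<close> the left-hand side of the eigenvalue equation has strictly grown.
\<close>

lemma edge_move_increases_radius:
  assumes G: "uniform k G" and k: "k \<ge> 2" and \<alpha>: "0 \<le> \<alpha>" "\<alpha> < 1" and conn: "hconnected G"
    and f: "f \<in> edges G" "p \<in> f" "u \<in> verts G" "u \<notin> f"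
    and f': "f' = insert u (f - {p})" "f' \<notin> edges G"
    and G': "verts G' = verts G" "edges G' = insert f' (edges G - {f})" "uniform k G'" "hconnected G'"
    and pos: "\<And>v. v \<in> verts G \<Longrightarrow> 0 < x v" and x1: "(\<Sum>v\<in>verts G. x v ^ k) = 1"
    and xR: "tensor_form k \<alpha> (edges G) x = alpha_spectral_radius k \<alpha> G"
    and up: "x p \<le> x u"
  shows "alpha_spectral_radius k \<alpha> G < alpha_spectral_radius k \<alpha> G'"
proof (rule ccontr)
  let ?V = "verts G" and ?E = "edges G" and ?E' = "edges G'"
  let ?R = "alpha_spectral_radius k \<alpha> G" and ?R' = "alpha_spectral_radius k \<alpha> G'"
  let ?W = "\<lambda>e. \<alpha> * (\<Sum>v\<in>e. x v ^ k) + (1 - \<alpha>) * real k * (\<Prod>v\<in>e. x v)"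
  note fin = uniform_finite[OF G]
  have ff: "finite f" "f \<subseteq> ?V" using f fin by auto
  have posf: "\<And>w. w \<in> f \<Longrightarrow> 0 < x w" using ff pos by auto
  \<comment> \<open>The move replaces \<open>x p\<close> by the no smaller \<open>x u\<close> in one
    power sum and one product; all other edges keep their terms.\<close>
  have W: "?W f \<le> ?W f'"
  proof -
    have "x p ^ k \<le> x u ^ k" using up posf[OF f(2)] by (intro power_mono) auto
    moreover have "(\<Sum>v\<in>f. x v ^ k) = x p ^ k + (\<Sum>v\<in>f - {p}. x v ^ k)"
      using ff f by (intro sum.remove) auto
    moreover have "(\<Sum>v\<in>f'. x v ^ k) = x u ^ k + (\<Sum>v\<in>f - {p}. x v ^ k)"
      using ff f f' by simp
    ultimately have "(\<Sum>v\<in>f. x v ^ k) \<le> (\<Sum>v\<in>f'. x v ^ k)" by simp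
    moreover have "(\<Prod>v\<in>f. x v) = x p * (\<Prod>v\<in>f - {p}. x v)"
      using ff f by (intro prod.remove) auto
    moreover have "(\<Prod>v\<in>f'. x v) = x u * (\<Prod>v\<in>f - {p}. x v)"
      using ff f f' by simp
    moreover have "0 \<le> (\<Prod>v\<in>f - {p}. x v)" using posf by (intro prod_nonneg) (auto simp: less_imp_le)
    ultimately have "(\<Sum>v\<in>f. x v ^ k) \<le> (\<Sum>v\<in>f'. x v ^ k)" "(\<Prod>v\<in>f. x v) \<le> (\<Prod>v\<in>f'. x v)"
      using up by (auto intro: mult_right_mono)
    then show ?thesis using \<alpha> by (intro add_mono mult_left_mono) auto
  qed
  have "tensor_form k \<alpha> ?E x = ?W f + (\<Sum>e\<in>?E - {f}. ?W e)"
    unfolding tensor_form_def using fin f by (intro sum.remove) auto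
  moreover have "tensor_form k \<alpha> ?E' x = ?W f' + (\<Sum>e\<in>?E - {f}. ?W e)"
    unfolding tensor_form_def G' using fin f' by (subst sum.insert) auto
  ultimately have "?R \<le> tensor_form k \<alpha> ?E' x" using W xR by simp
  moreover have "tensor_form k \<alpha> ?E' x \<le> ?R' * (\<Sum>v\<in>verts G'. x v ^ k)"
    using alpha_spectral_radius_variational[OF G'(3) k \<alpha> G'(4)] pos G'(1) less_imp_le by metis
  moreover assume "\<not> ?R < ?R'"
  ultimately have R: "?R' = ?R" and xR': "tensor_form k \<alpha> ?E' x = ?R' * (\<Sum>v\<in>verts G'. x v ^ k)"
    using x1 G'(1) by auto
  have eq: "\<alpha> * real (vertex_degree G u) * x u ^ (k - 1) + (1 - \<alpha>) * nbr_sum ?E x u = ?R * x u ^ (k - 1)"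
    by (rule alpha_spectral_radius_eigenvector[OF G k \<alpha> conn f(3) pos]) (simp_all add: xR x1)
  have eq': "\<alpha> * real (vertex_degree G' u) * x u ^ (k - 1) + (1 - \<alpha>) * nbr_sum ?E' x u = ?R' * x u ^ (k - 1)"
    using alpha_spectral_radius_eigenvector[OF G'(3) k \<alpha> G'(4), of u x] f(3) pos xR' G'(1) by simp
  have Eu: "{e. e \<in> ?E' \<and> u \<in> e} = insert f' {e. e \<in> ?E \<and> u \<in> e}"
    using f f' G'(2) by auto
  have "vertex_degree G' u = Suc (vertex_degree G u)"
    unfolding vertex_degree_def Eu using fin(2) f' by simp
  moreover have "nbr_sum ?E' x u = (\<Prod>w\<in>f' - {u}. x w) + nbr_sum ?E x u"
    unfolding nbr_sum_def Eu using fin(2) f' by (subst sum.insert) auto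
  moreover have "0 < (\<Prod>w\<in>f' - {u}. x w)" using posf f' by (intro prod_pos) auto
  moreover have "0 \<le> x u ^ (k - 1)" using pos[OF f(3)] by simp
  \<comment> \<open>Difference of the two eigenvalue equations at \<open>u\<close>. The first term
    may vanish (\<open>\<alpha> = 0\<close>), but the product term is strictly positive because
    \<open>\<alpha> < 1\<close>.\<close>
  ultimately have "\<alpha> * x u ^ (k - 1) + (1 - \<alpha>) * (\<Prod>w\<in>f' - {u}. x w) = 0"
    "0 \<le> \<alpha> * x u ^ (k - 1)" "0 < (1 - \<alpha>) * (\<Prod>w\<in>f' - {u}. x w)"
    using eq eq' R \<alpha> by (simp_all add: algebra_simps del: mult_pos_pos)
  then show False by linarith
qed

section \<open>Moving an edge of a supertree\<close>

lemma hadj_rtrancl_sym: "(x, y) \<in> (hadj E)\<^sup>* \<Longrightarrow> (y, x) \<in> (hadj E)\<^sup>*"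
proof -
  have "sym (hadj E)" by (auto simp: sym_def hadj_def)
  then show "(x, y) \<in> (hadj E)\<^sup>* \<Longrightarrow> (y, x) \<in> (hadj E)\<^sup>*"
    using sym_rtrancl symD by metis
qed

lemma hadj_rtrancl_mono: "(x, y) \<in> (hadj E)\<^sup>* \<Longrightarrow> E \<subseteq> E' \<Longrightarrow> (x, y) \<in> (hadj E')\<^sup>*"
proof -
  assume xy: "(x, y) \<in> (hadj E)\<^sup>*" and "E \<subseteq> E'"
  then have "hadj E \<subseteq> hadj E'" by (auto simp: hadj_def)
  from subsetD[OF rtrancl_mono[OF this] xy] show "(x, y) \<in> (hadj E')\<^sup>*" .
qed

lemma hadj_rtrancl_edge: "e \<in> E \<Longrightarrow> x \<in> e \<Longrightarrow> y \<in> e \<Longrightarrow> (x, y) \<in> (hadj E)\<^sup>*"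
  by (rule r_into_rtrancl) (auto simp: hadj_def)

text \<open>Acyclicity in a form that needs no explicit cycles; see \<open>supertree_iff\<close>.\<close>

definition edge_separating :: "'a set set \<Rightarrow> bool" where
  "edge_separating E \<longleftrightarrow>
     (\<forall>e\<in>E. \<forall>a\<in>e. \<forall>b\<in>e. a \<noteq> b \<longrightarrow> (a, b) \<notin> (hadj (E - {e}))\<^sup>*)"

lemma edge_separatingD:
  "edge_separating E \<Longrightarrow> e \<in> E \<Longrightarrow> a \<in> e \<Longrightarrow> b \<in> e \<Longrightarrow> (a, b) \<in> (hadj (E - {e}))\<^sup>* \<Longrightarrow> a = b"
  unfolding edge_separating_def by blast

text \<open>After \<open>e\<close> is deleted, \<open>e'\<close> would still join two common
  vertices.\<close>

lemma edge_separating_inter: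
  assumes "edge_separating E" "e \<in> E" "e' \<in> E" "e \<noteq> e'" "a \<in> e" "a \<in> e'" "b \<in> e" "b \<in> e'"
  shows "a = b"
proof (rule edge_separatingD[OF assms(1,2,5,7)])
  show "(a, b) \<in> (hadj (E - {e}))\<^sup>*"
    using assms by (intro hadj_rtrancl_edge[of e']) simp_all
qed

lemma hacyclic_imp_edge_separating:
  assumes ac: "hacyclic G" and sub: "\<And>e. e \<in> edges G \<Longrightarrow> e \<subseteq> verts G"
  shows "edge_separating (edges G)"
  unfolding edge_separating_def
proof (intro ballI impI notI)
  fix e a b
  assume e: "e \<in> edges G" "a \<in> e" "b \<in> e" "a \<noteq> b"
    and ab: "(a, b) \<in> (hadj (edges G - {e}))\<^sup>*"
  define F where "F = edges G - {e}"
  \<comment> \<open>A shortest path repeats neither vertices nor edges, so together with \<open>e\<close> it is a cycle.\<close>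
  define n where "n = (LEAST n. (a, b) \<in> hadj F ^^ n)"
  have "\<exists>n. (a, b) \<in> hadj F ^^ n" using ab rtrancl_imp_relpow unfolding F_def by metis
  then have n: "(a, b) \<in> hadj F ^^ n" unfolding n_def by (rule LeastI_ex)
  have least: "n \<le> d" if "(a, b) \<in> hadj F ^^ d" for d
    unfolding n_def using that by (rule Least_le)
  obtain f where f: "f 0 = a" "f n = b" and step: "\<And>i. i < n \<Longrightarrow> (f i, f (Suc i)) \<in> hadj F"
    using n by (auto simp: relpow_fun_conv)
  from step have "\<forall>i. \<exists>g. i < n \<longrightarrow> g \<in> F \<and> f i \<in> g \<and> f (Suc i) \<in> g"
    by (fastforce simp: hadj_def)
  then obtain g where "\<forall>i. i < n \<longrightarrow> g i \<in> F \<and> f i \<in> g i \<and> f (Suc i) \<in> g i"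
    using choice by metis
  then have g: "\<And>i. i < n \<Longrightarrow> g i \<in> F" "\<And>i. i < n \<Longrightarrow> f i \<in> g i" "\<And>i. i < n \<Longrightarrow> f (Suc i) \<in> g i"
    by auto
  have seg: "(f i, f (i + d)) \<in> hadj F ^^ d" if "i + d \<le> n" for i d
    unfolding relpow_fun_conv using that step by (intro exI[of _ "\<lambda>l. f (i + l)"]) auto
  \<comment> \<open>Replacing the stretch from \<open>f i\<close> to \<open>f j\<close> by
    \<open>d\<close> steps gives a path from \<open>a\<close> to \<open>b\<close> of length
    \<open>i + d + (n - j)\<close>, which minimality bounds below by \<open>n\<close>. A repeated
    vertex would be such a shortcut with \<open>d = 0\<close>, a repeated edge one with
    \<open>d = 1\<close>.\<close>
  have short: "j - i \<le> d" if "i \<le> j" "j \<le> n" "(f i, f j) \<in> hadj F ^^ d" for i j d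
  proof -
    have "(a, f i) \<in> hadj F ^^ i" "(f j, b) \<in> hadj F ^^ (n - j)"
      using seg[of 0 i] seg[of j "n - j"] that f by auto
    then have "(a, b) \<in> hadj F ^^ (i + d + (n - j))"
      using that(3) unfolding relpow_add by blast
    from least[OF this] show ?thesis using that by simp
  qed
  have fd: "f i \<noteq> f j" if "i < j" "j \<le> n" for i j
    using short[of i j 0] that by auto
  have gd: "g i \<noteq> g j" if "i < j" "j < n" for i j
  proof
    assume "g i = g j"
    then have "(f i, f (Suc j)) \<in> hadj F" using g[of i] g[of j] that by (auto simp: hadj_def)
    then show False using short[of i "Suc j" 1] that by auto
  qed
  define vs where "vs = map f [0..<Suc n]"
  \<comment> \<open>The last edge \<open>e\<close> leads from \<open>f n = b\<close> back to
    \<open>f 0 = a\<close>; \<open>a \<noteq> b\<close> gives \<open>n > 0\<close>, hence length at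
    least 2.\<close>
  define es where "es = map g [0..<n] @ [e]"
  have n0: "n > 0" using f e(4) by (cases n) auto
  have "inj_on f {0..<Suc n}" "inj_on g {0..<n}"
    using fd gd by (auto intro!: linorder_inj_onI simp: less_Suc_eq_le)
  moreover have "e \<notin> g ` {0..<n}" using g(1) by (force simp: F_def)
  ultimately have dist: "distinct vs" "distinct es"
    by (auto simp: vs_def es_def distinct_map F_def simp del: upt_Suc)
  have set_vs: "set vs \<subseteq> verts G"
  proof
    fix v assume "v \<in> set vs"
    then obtain i where i: "i \<le> n" "v = f i" by (auto simp: vs_def less_Suc_eq_le simp del: upt_Suc)
    show "v \<in> verts G"
    proof (cases "i = n")
      case True
      then show ?thesis using f e sub i by auto
    next
      case False
      then show ?thesis using g[of i] i sub[of "g i"] by (auto simp: F_def)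
    qed
  qed
  have set_es: "set es \<subseteq> edges G" using e g(1) by (auto simp: es_def F_def)
  have "vs ! i \<in> es ! i \<and> vs ! (Suc i mod length es) \<in> es ! i" if "i < length es" for i
  proof (cases "i = n")
    case True
    then show ?thesis using f e by (simp add: vs_def es_def nth_append del: upt_Suc)
  next
    case False
    then have "i < n" using that by (simp add: es_def)
    then show ?thesis using g[of i] by (simp add: vs_def es_def nth_append del: upt_Suc)
  qed
  then have "is_cycle G vs es"
    unfolding is_cycle_def using dist set_vs set_es n0 by (auto simp: vs_def es_def simp del: upt_Suc)
  then show False using ac by (auto simp: hacyclic_def)
qed

text \<open>The rest of a cycle, without its edge \<open>es ! 0\<close>, is a path from
  \<open>vs ! 1\<close> round to \<open>vs ! 0\<close>, two vertices of the deleted edge.\<close>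

lemma edge_separating_imp_hacyclic:
  assumes sep: "edge_separating (edges G)"
  shows "hacyclic G"
  unfolding hacyclic_def
proof (intro notI, elim exE)
  fix vs es assume cyc: "is_cycle G vs es"
  define l where "l = length es"
  have l: "length vs = l" "length es = l" "2 \<le> l" and d: "distinct vs" "distinct es"
    and es: "set es \<subseteq> edges G"
    and inc: "\<And>i. i < l \<Longrightarrow> vs ! i \<in> es ! i" "\<And>i. i < l \<Longrightarrow> vs ! (Suc i mod l) \<in> es ! i"
    using cyc by (auto simp: is_cycle_def l_def)
  let ?F = "edges G - {es ! 0}"
  have edge: "es ! i \<in> ?F" if "0 < i" "i < l" for i
    using that es d l by (auto simp: nth_eq_iff_index_eq subset_iff)
  have path: "Suc i < l \<Longrightarrow> (vs ! 1, vs ! Suc i) \<in> (hadj ?F)\<^sup>*" for i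
  proof (induction i)
    case (Suc i)
    then have "(vs ! Suc i, vs ! Suc (Suc i)) \<in> (hadj ?F)\<^sup>*"
      using inc[of "Suc i"] edge[of "Suc i"] by (intro hadj_rtrancl_edge) auto
    then show ?case using Suc by (auto intro: rtrancl_trans)
  qed simp
  have "(vs ! (l - 1), vs ! 0) \<in> (hadj ?F)\<^sup>*"
    using inc[of "l - 1"] edge[of "l - 1"] l by (intro hadj_rtrancl_edge[of "es ! (l - 1)"]) auto
  moreover have "(vs ! 1, vs ! (l - 1)) \<in> (hadj ?F)\<^sup>*" using path[of "l - 2"] l
    by (simp add: numeral_2_eq_2 Suc_diff_Suc)
  ultimately have "(vs ! 1, vs ! 0) \<in> (hadj ?F)\<^sup>*" by (rule rtrancl_trans[rotated])
  moreover have "vs ! 1 \<in> es ! 0" "vs ! 0 \<in> es ! 0" using inc[of 0] l by auto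
  moreover have "es ! 0 \<in> edges G" using es l by (auto simp: subset_iff)
  ultimately have "vs ! 1 = vs ! 0" using edge_separatingD[OF sep] by blast
  then show False using d l by (auto simp: nth_eq_iff_index_eq)
qed

lemma supertree_iff:
  "supertree k G \<longleftrightarrow> uniform k G \<and> hconnected G \<and> edge_separating (edges G)"
proof -
  have "hacyclic G \<longleftrightarrow> edge_separating (edges G)" if "uniform k G"
    using hacyclic_imp_edge_separating[OF _ uniform_finite(4)[OF that]] edge_separating_imp_hacyclic
    by blast
  then show ?thesis unfolding supertree_def by blast
qed

text \<open>Cut the path before its first and after its last use of \<open>h\<close>; the two outer
  stretches stay in \<open>F\<close>.\<close>

lemma hadj_rtrancl_insert:
  assumes "(a, b) \<in> (hadj (insert h F))\<^sup>*"
  shows "(a, b) \<in> (hadj F)\<^sup>* \<or> (\<exists>x\<in>h. \<exists>y\<in>h. (a, x) \<in> (hadj F)\<^sup>* \<and> (y, b) \<in> (hadj F)\<^sup>*)"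
  using assms
proof (induction rule: rtrancl_induct)
  case (step y z)
  then obtain g where g: "g = h \<or> g \<in> F" "y \<in> g" "z \<in> g" by (auto simp: hadj_def)
  show ?case
  proof (cases "g \<in> F")
    case True
    then have "(y, z) \<in> hadj F" using g by (auto simp: hadj_def)
    then show ?thesis using step.IH by (meson rtrancl.rtrancl_into_rtrancl)
  next
    case False
    then show ?thesis using g step.IH by blast
  qed
qed simp

text \<open>This \<open>p\<close> plays the part of the vertex of \<open>f\<close> closest to
  \<open>u\<close>: a path to \<open>f\<close> arrives there before using \<open>f\<close>.\<close>

lemma hadj_reaches_edge:
  assumes "(u, w) \<in> (hadj E)\<^sup>*" "w \<in> f"
  obtains p where "p \<in> f" "(u, p) \<in> (hadj (E - {f}))\<^sup>*"
proof -
  have "(u, w) \<in> (hadj (insert f (E - {f})))\<^sup>*"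
    using assms(1) by (rule hadj_rtrancl_mono) auto
  from hadj_rtrancl_insert[OF this] show ?thesis using that assms(2) by blast
qed

text \<open>Here \<open>k \<ge> 3\<close> enters: \<open>f - {p}\<close> keeps two vertices, which
  two distinct edges cannot share.\<close>

lemma edge_move_not_edge:
  assumes sep: "edge_separating E" and f: "f \<in> E" "u \<notin> f" "3 \<le> card f"
  shows "insert u (f - {p}) \<notin> E"
proof
  assume "insert u (f - {p}) \<in> E"
  moreover have "insert u (f - {p}) \<noteq> f" using f by auto
  ultimately have "\<forall>a\<in>f - {p}. \<forall>b\<in>f - {p}. a = b"
    using edge_separating_inter[OF sep _ f(1)] by blast
  moreover have "finite f" using f(3) by (auto intro: card_ge_0_finite)
  ultimately have "card (f - {p}) \<le> 1" by (auto simp: card_le_Suc0_iff_eq)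
  moreover have "card f - 1 \<le> card (f - {p})" by (simp add: card_Diff_singleton_if)
  ultimately show False using f by simp
qed

lemma edge_move_separating:
  assumes sep: "edge_separating E" and f: "f \<in> E" "u \<notin> f" "p \<in> f"
    and up: "(u, p) \<in> (hadj (E - {f}))\<^sup>*" and f'E: "insert u (f - {p}) \<notin> E"
  shows "edge_separating (insert (insert u (f - {p})) (E - {f}))"
  unfolding edge_separating_def
proof (intro ballI impI notI)
  define f' where "f' = insert u (f - {p})"
  fix g a b
  assume g: "g \<in> insert (insert u (f - {p})) (E - {f})" and ab: "a \<in> g" "b \<in> g" "a \<noteq> b"
    and r: "(a, b) \<in> (hadj (insert (insert u (f - {p})) (E - {f}) - {g}))\<^sup>*"
  let ?F = "E - {f}"
  have f'n: "f' \<notin> E" using f'E by (simp add: f'_def)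
  have sepf: "x = y" if "x \<in> f" "y \<in> f" "(x, y) \<in> (hadj ?F)\<^sup>*" for x y
    using edge_separatingD[OF sep f(1) that] .
  have sepu: False if "(u, y) \<in> (hadj ?F)\<^sup>*" "y \<in> f - {p}" for y
    using sepf[of p y] that f hadj_rtrancl_sym[OF up] by (auto dest: rtrancl_trans)
  \<comment> \<open>The mixed detour: from \<open>g\<close> to \<open>u\<close>, across the new edge
    to \<open>y\<close>, and back to \<open>g\<close>. Then \<open>g\<close> itself links
    \<open>u\<close> to \<open>y\<close> without \<open>f\<close>, against
    \<open>sepu\<close>.\<close>
  have key: False if "a \<in> g" "b \<in> g" "a \<noteq> b" "g \<in> ?F" "y \<in> f - {p}"
    "(a, u) \<in> (hadj (?F - {g}))\<^sup>*" "(y, b) \<in> (hadj (?F - {g}))\<^sup>*" for a b y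
  proof -
    have "(u, a) \<in> (hadj ?F)\<^sup>*" using that(6) by (meson hadj_rtrancl_sym hadj_rtrancl_mono Diff_subset)
    moreover have "(b, y) \<in> (hadj ?F)\<^sup>*" using that(7) by (meson hadj_rtrancl_sym hadj_rtrancl_mono Diff_subset)
    moreover have "(a, b) \<in> (hadj ?F)\<^sup>*" using that by (intro hadj_rtrancl_edge) auto
    ultimately have "(u, y) \<in> (hadj ?F)\<^sup>*" by (meson rtrancl_trans)
    then show False using sepu that by blast
  qed
  show False
  proof (cases "g = f'")
    case True
    then have "insert (insert u (f - {p})) (E - {f}) - {g} = ?F" using f'n by (auto simp: f'_def)
    then have r: "(a, b) \<in> (hadj ?F)\<^sup>*" using r by simp
    then show False
      using sepf[of a b] sepu[of a] sepu[of b] hadj_rtrancl_sym[OF r] ab True by (auto simp: f'_def)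
  next
    case False
    then have gF: "g \<in> ?F" using g by (simp add: f'_def)
    have "insert (insert u (f - {p})) (E - {f}) - {g} = insert f' (?F - {g})"
      using False by (auto simp: f'_def)
    then have r: "(a, b) \<in> (hadj (insert f' (?F - {g})))\<^sup>*" using r by simp
    have no: "(a, b) \<notin> (hadj (E - {g}))\<^sup>*"
      using edge_separatingD[OF sep _ ab(1,2)] ab(3) gF by auto
    then have no': "(a, b) \<notin> (hadj (?F - {g}))\<^sup>*"
      using hadj_rtrancl_mono[of a b "?F - {g}" "E - {g}"] by auto
    then obtain x y where xy: "x \<in> f'" "y \<in> f'" "(a, x) \<in> (hadj (?F - {g}))\<^sup>*" "(y, b) \<in> (hadj (?F - {g}))\<^sup>*"
      using hadj_rtrancl_insert[OF r] by blast
    \<comment> \<open>The detour enters the new edge at \<open>x\<close> and leaves it at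
      \<open>y\<close>. If both are \<open>u\<close>, it does not need that edge; if both lie in
      \<open>f\<close>, the old edge \<open>f\<close> gives the same detour in \<open>E\<close>; the
      other two cases are \<open>key\<close>.\<close>
    consider "x = u" "y = u" | "x = u" "y \<in> f - {p}" | "y = u" "x \<in> f - {p}" | "x \<in> f" "y \<in> f"
      using xy by (auto simp: f'_def)
    then show False
    proof cases
      case 1
      then show False using xy no' by (auto dest: rtrancl_trans)
    next
      case 2
      then show False using key[OF ab gF _ _ xy(4)] xy by auto
    next
      case 3
      then show False
        using key[OF ab(2,1) ab(3)[symmetric] gF 3(2)] hadj_rtrancl_sym[OF xy(3)] hadj_rtrancl_sym[OF xy(4)]
        by auto
    next
      case 4
      have "(x, y) \<in> (hadj (E - {g}))\<^sup>*" using 4 f gF by (intro hadj_rtrancl_edge[of f]) auto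
      moreover have "(a, x) \<in> (hadj (E - {g}))\<^sup>*" "(y, b) \<in> (hadj (E - {g}))\<^sup>*"
        using xy hadj_rtrancl_mono[of _ _ "?F - {g}" "E - {g}"] by auto
      ultimately show False using no by (meson rtrancl_trans)
    qed
  qed
qed

text \<open>With \<open>u\<close> as a hub, every vertex of \<open>f\<close> stays reachable:
  \<open>p\<close> along the path avoiding \<open>f\<close>, the others through the new
  edge.\<close>

lemma edge_move_connected:
  assumes up: "(u, p) \<in> (hadj (E - {f}))\<^sup>*" and ab: "(a, b) \<in> (hadj E)\<^sup>*"
  shows "(a, b) \<in> (hadj (insert (insert u (f - {p})) (E - {f})))\<^sup>*"
  using ab
proof (induction rule: rtrancl_induct)
  case (step y z)
  let ?E' = "insert (insert u (f - {p})) (E - {f})"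
  obtain g where g: "g \<in> E" "y \<in> g" "z \<in> g" using step(2) by (auto simp: hadj_def)
  have up': "(u, p) \<in> (hadj ?E')\<^sup>*" using up by (rule hadj_rtrancl_mono) auto
  have u: "(u, w) \<in> (hadj ?E')\<^sup>*" if "w \<in> f" for w
    using up' that by (cases "w = p") (auto intro: hadj_rtrancl_edge[of "insert u (f - {p})"])
  have "(y, z) \<in> (hadj ?E')\<^sup>*"
  proof (cases "g = f")
    case True
    then show ?thesis using u[of y] u[of z] g hadj_rtrancl_sym by (meson rtrancl_trans)
  next
    case False
    then show ?thesis using g by (intro hadj_rtrancl_edge[of g]) auto
  qed
  then show ?case using step.IH by (rule rtrancl_trans[rotated])
qed simp

lemma edge_move_supertree:
  assumes T: "supertree k G" and k: "3 \<le> k" and f: "f \<in> edges G" "u \<in> verts G" "u \<notin> f" "p \<in> f"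
    and up: "(u, p) \<in> (hadj (edges G - {f}))\<^sup>*"
  shows "supertree k \<lparr>verts = verts G, edges = insert (insert u (f - {p})) (edges G - {f})\<rparr>"
    and "insert u (f - {p}) \<notin> edges G"
proof -
  have G: "uniform k G" and conn: "hconnected G" and sep: "edge_separating (edges G)"
    using T by (auto simp: supertree_iff)
  note fin = uniform_finite[OF G]
  have ff: "finite f" "f \<subseteq> verts G" "card f = k" using fin f by auto
  show n: "insert u (f - {p}) \<notin> edges G" using edge_move_not_edge[OF sep f(1,3)] ff k by simp
  have "card (insert u (f - {p})) = k" using ff f k by simp
  then have "uniform k \<lparr>verts = verts G, edges = insert (insert u (f - {p})) (edges G - {f})\<rparr>"
    using G f ff by (auto simp: uniform_def)
  then show "supertree k \<lparr>verts = verts G, edges = insert (insert u (f - {p})) (edges G - {f})\<rparr>"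
    using edge_move_separating[OF sep f(1,3,4) up n] conn edge_move_connected[OF up]
    by (simp add: supertree_iff hconnected_iff)
qed

section \<open>Stars and double stars\<close>

text \<open>\<open>C\<close> collects the vertices of the underlying graph. The other
  \<open>k - 2\<close> vertices of an edge lie on no other edge, so any numbering of them serves as
  the new vertices of the power.\<close>

lemma isomorphic_power_hypergraph:
  assumes T: "uniform k T" and C: "C \<subseteq> verts T"
    and h: "bij_betw h C (verts H)"
    and hE: "bij_betw (\<lambda>e. h ` (e \<inter> C)) (edges T) (edges H)"
    and c2: "\<And>e. e \<in> edges T \<Longrightarrow> card (e \<inter> C) = 2"
    and uniq: "\<And>v. v \<in> verts T - C \<Longrightarrow> \<exists>!e. e \<in> edges T \<and> v \<in> e"
  shows "isomorphic T (power_hypergraph k H)"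
proof -
  note fin = uniform_finite[OF T]
  let ?E = "edges T" and ?V = "verts T"
  define \<phi> where "\<phi> = (\<lambda>e. h ` (e \<inter> C))"
  have \<phi>: "inj_on \<phi> ?E" "\<phi> ` ?E = edges H" using hE by (auto simp: \<phi>_def bij_betw_def)
  have hC: "inj_on h C" "h ` C = verts H" using h by (auto simp: bij_betw_def)
  have "\<exists>g. bij_betw g (e - C) {..<k - 2}" if "e \<in> ?E" for e
  proof (rule finite_same_card_bij)
    have "card (e - C) = card e - card (e \<inter> C)"
      using fin(3)[OF that] by (simp add: card_Diff_subset_Int)
    then show "card (e - C) = card {..<k - 2}" using fin(5)[OF that] c2[OF that] by simp
  qed (use fin(3) that in auto)
  then obtain idx where idx: "\<And>e. e \<in> ?E \<Longrightarrow> bij_betw (idx e) (e - C) {..<k - 2}" by metis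
  define ed where "ed = (\<lambda>v. THE e. e \<in> ?E \<and> v \<in> e)"
  have ed: "ed v \<in> ?E" "v \<in> ed v" if "v \<in> ?V - C" for v
    using theI'[OF uniq[OF that]] by (auto simp: ed_def)
  have ed_eq: "ed v = e" if "e \<in> ?E" "v \<in> e - C" for e v
    using that uniq[of v] ed[of v] fin(4)[OF that(1)] by blast
  define F where "F = (\<lambda>v. if v \<in> C then Inl (h v) else Inr (\<phi> (ed v), idx (ed v) v))"
  have Fpend: "F ` (e - C) = Inr ` ({\<phi> e} \<times> {..<k - 2})" if e: "e \<in> ?E" for e
  proof -
    have "F ` (e - C) = (\<lambda>v. Inr (\<phi> e, idx e v)) ` (e - C)"
      using ed_eq[OF e] by (intro image_cong) (auto simp: F_def)
    also have "\<dots> = Inr ` ({\<phi> e} \<times> idx e ` (e - C))" by auto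
    finally show ?thesis using idx[OF e] by (simp add: bij_betw_def)
  qed
  have FC: "F ` A = Inl ` h ` A" if "A \<subseteq> C" for A
    using that by (auto simp: F_def image_image intro!: image_cong)
  have Fe: "F ` e = \<phi> e <+> {\<phi> e} \<times> {..<k - 2}" if "e \<in> ?E" for e
  proof -
    have "F ` e = F ` (e \<inter> C) \<union> F ` (e - C)" by (auto simp: image_Un[symmetric] Int_Diff_Un)
    then show ?thesis using FC[of "e \<inter> C"] Fpend[OF that] by (simp add: Plus_def \<phi>_def)
  qed
  have "F ` ?V = F ` C \<union> (\<Union>e\<in>?E. F ` (e - C))"
  proof -
    have "v \<in> (\<Union>e\<in>?E. e - C)" if "v \<in> ?V - C" for v
      using ed[OF that] that by auto
    moreover have "(\<Union>e\<in>?E. e - C) \<subseteq> ?V" using fin(4) by auto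
    ultimately have "?V = C \<union> (\<Union>e\<in>?E. e - C)" using C by auto
    then have "F ` ?V = F ` (C \<union> (\<Union>e\<in>?E. e - C))" by (rule arg_cong)
    also have "\<dots> = F ` C \<union> (\<Union>e\<in>?E. F ` (e - C))" by (simp only: image_Un image_UN)
    finally show ?thesis .
  qed
  also have "\<dots> = Inl ` verts H \<union> (\<Union>e\<in>?E. Inr ` ({\<phi> e} \<times> {..<k - 2}))"
    using FC[of C] hC Fpend by simp
  also have "\<dots> = verts H <+> edges H \<times> {..<k - 2}"
    unfolding \<phi>(2)[symmetric] Plus_def by auto
  finally have FV: "F ` ?V = verts H <+> edges H \<times> {..<k - 2}" .
  have "inj_on F ?V"
  proof (rule inj_onI)
    fix v w assume vw: "v \<in> ?V" "w \<in> ?V" "F v = F w"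
    show "v = w"
    proof (cases "v \<in> C")
      case True
      then show ?thesis using vw hC(1) by (auto simp: F_def inj_on_def split: if_splits)
    next
      case False
      then have w: "w \<notin> C" "\<phi> (ed v) = \<phi> (ed w)" "idx (ed v) v = idx (ed w) w"
        using vw(3) by (auto simp: F_def split: if_splits)
      then have "ed v = ed w" using \<phi>(1) ed vw False by (auto simp: inj_on_def)
      then show ?thesis using w(3) idx[OF ed(1), of v] ed(2)[of v] ed(2)[of w] vw False w(1)
        by (auto simp: bij_betw_def inj_on_def)
    qed
  qed
  then have "bij_betw F ?V (verts (power_hypergraph k H))"
    using FV by (simp add: bij_betw_def power_hypergraph_def)
  moreover have "edges (power_hypergraph k H) = (\<lambda>e. F ` e) ` ?E"
  proof -
    have "edges (power_hypergraph k H) = (\<lambda>e. \<phi> e <+> {\<phi> e} \<times> {..<k - 2}) ` ?E"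
      unfolding power_hypergraph_def \<phi>(2)[symmetric] by (simp only: hypergraph.simps image_image)
    also have "\<dots> = (\<lambda>e. F ` e) ` ?E" using Fe by (intro image_cong) simp_all
    finally show ?thesis .
  qed
  ultimately show ?thesis unfolding isomorphic_def by (intro exI[of _ F] conjI)
qed

text \<open>
  The core of a power of a tree: a root \<open>u\<close> labelled \<open>r\<close>, and for each edge \<open>e\<close> the vertex
  \<open>c e\<close> of its graph edge farther from the root, labelled \<open>\<iota> e\<close>.
\<close>

lemma core_labelling:
  assumes "inj_on c E" "u \<notin> c ` E" "inj_on \<iota> E" "r \<notin> \<iota> ` E"
  obtains h where "h u = r" "\<And>e. e \<in> E \<Longrightarrow> h (c e) = \<iota> e"
    "bij_betw h (insert u (c ` E)) (insert r (\<iota> ` E))"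
proof -
  define h where "h = (\<lambda>v. if v = u then r else \<iota> (inv_into E c v))"
  have hu: "h u = r" and hc: "\<And>e. e \<in> E \<Longrightarrow> h (c e) = \<iota> e"
    using assms by (auto simp: h_def)
  have im: "h ` c ` E = \<iota> ` E" unfolding image_image using hc by (rule image_cong[OF refl])
  have "inj_on h (c ` E)"
  proof (rule inj_onI)
    fix v w assume "v \<in> c ` E" "w \<in> c ` E" and eq: "h v = h w"
    then obtain d e where "d \<in> E" "v = c d" "e \<in> E" "w = c e" by blast
    then show "v = w" using eq hc inj_onD[OF assms(3), of d e] by metis
  qed
  moreover have "h u \<notin> h ` (c ` E - {u})"
    using assms(4) hu im by (metis Diff_subset image_mono subsetD)
  ultimately have "inj_on h (insert u (c ` E))" unfolding inj_on_insert ..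
  moreover have "h ` insert u (c ` E) = insert r (\<iota> ` E)" using im hu by simp
  ultimately show ?thesis using that[of h] hu hc by (simp add: bij_betw_def)
qed

lemma vertex_in_edge:
  assumes "hconnected G" "u \<in> verts G" "v \<in> verts G" "u \<noteq> v"
  shows "\<exists>e\<in>edges G. v \<in> e"
proof -
  have "(u, v) \<in> (hadj (edges G))\<^sup>*" using assms by (auto simp: hconnected_iff)
  then show ?thesis using assms(4) by (cases rule: rtranclE) (auto simp: hadj_def)
qed

text \<open>Edges through \<open>u\<close> are disjoint elsewhere, so any further vertex
  \<open>c e\<close> of an edge can serve as its leaf.\<close>

lemma supertree_universal_vertex:
  assumes T: "supertree k T" and k: "2 \<le> k" and m: "card (edges T) = m"
    and u: "u \<in> verts T" "\<And>e. e \<in> edges T \<Longrightarrow> u \<in> e"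
  shows "isomorphic T (power_hypergraph k (star_graph m))"
proof -
  let ?E = "edges T"
  have G: "uniform k T" and conn: "hconnected T" and sep: "edge_separating ?E"
    using T by (auto simp: supertree_iff)
  note fin = uniform_finite[OF G]
  have share: "e = e'" if "e \<in> ?E" "e' \<in> ?E" "v \<in> e" "v \<in> e'" "v \<noteq> u" for e e' v
    using edge_separating_inter[OF sep that(1,2) _ that(3,4)] u(2) that by blast
  have "\<exists>v. v \<in> e - {u}" if "e \<in> ?E" for e
  proof (rule ccontr)
    assume "\<not> ?thesis"
    then have "card e \<le> card {u}" by (intro card_mono) auto
    then show False using fin(5)[OF that] k by simp
  qed
  then obtain c where c: "\<And>e. e \<in> ?E \<Longrightarrow> c e \<in> e - {u}" by metis
  have injc: "inj_on c ?E" using share c by (metis DiffE inj_onI insertI1)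
  obtain \<iota> where \<iota>: "bij_betw \<iota> ?E {1..m}"
    using finite_same_card_bij[OF fin(2), of "{1..m}"] m by auto
  define C where "C = insert u (c ` ?E)"
  have "u \<notin> c ` ?E" using c by auto
  moreover have "inj_on \<iota> ?E" and im: "\<iota> ` ?E = {1..m}" using \<iota> by (auto simp: bij_betw_def)
  moreover have "0 \<notin> \<iota> ` ?E" unfolding im by simp
  ultimately obtain h where h: "h u = 0" "\<And>e. e \<in> ?E \<Longrightarrow> h (c e) = \<iota> e"
    "bij_betw h C (insert 0 {1..m})"
    using core_labelling[OF injc, of u \<iota> 0] unfolding C_def im[symmetric] by metis
  have eC: "e \<inter> C = {u, c e}" if "e \<in> ?E" for e
    using c u(2) share that by (fastforce simp: C_def)
  show ?thesis
  proof (rule isomorphic_power_hypergraph[OF G])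
    show "C \<subseteq> verts T" using c fin(4) u by (auto simp: C_def)
    have "insert 0 {1..m} = verts (star_graph m)" by (auto simp: star_graph_def)
    then show "bij_betw h C (verts (star_graph m))" using h by simp
    have "bij_betw (\<lambda>i. {0, i}) {1..m} (edges (star_graph m))"
      by (auto simp: star_graph_def bij_betw_def inj_on_def doubleton_eq_iff)
    then have "bij_betw ((\<lambda>i. {0, i}) \<circ> \<iota>) ?E (edges (star_graph m))"
      using \<iota> by (rule bij_betw_trans[rotated])
    then show "bij_betw (\<lambda>e. h ` (e \<inter> C)) ?E (edges (star_graph m))"
      by (rule bij_betw_cong[THEN iffD1, rotated]) (simp add: eC h)
    show "card (e \<inter> C) = 2" if "e \<in> ?E" for e using eC[OF that] c[OF that] by auto
    show "\<exists>!e. e \<in> ?E \<and> v \<in> e" if "v \<in> verts T - C" for v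
      using vertex_in_edge[OF conn u(1), of v] share[of _ _ v] that by (auto simp: C_def)
  qed
qed

text \<open>The edge \<open>f\<close> hangs at a vertex \<open>p\<close> of a single edge
  \<open>e0\<close> through \<open>u\<close>. The pair \<open>p\<close>, \<open>u\<close> becomes
  the central edge of the double star.\<close>

lemma supertree_almost_universal_vertex:
  assumes T: "supertree k T" and k: "2 \<le> k" and m: "card (edges T) = m"
    and u: "u \<in> verts T" "\<And>e. e \<in> edges T \<Longrightarrow> e \<noteq> f \<Longrightarrow> u \<in> e"
    and f: "f \<in> edges T" "u \<notin> f"
  shows "isomorphic T (power_hypergraph k (double_star 1 (m - 2)))"
proof -
  let ?E = "edges T"
  have G: "uniform k T" and conn: "hconnected T" and sep: "edge_separating ?E"
    using T by (auto simp: supertree_iff)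
  note fin = uniform_finite[OF G]
  have big: "\<exists>v. v \<in> e - {z}" if "e \<in> ?E" for e z
  proof (rule ccontr)
    assume "\<not> ?thesis"
    then have "card e \<le> card {z}" by (intro card_mono) auto
    then show False using fin(5)[OF that] k by simp
  qed
  obtain w where w: "w \<in> f" using big[OF f(1)] by blast
  then have "(u, w) \<in> (hadj ?E)\<^sup>*" using conn u(1) fin(4)[OF f(1)] by (auto simp: hconnected_iff)
  then obtain p where p: "p \<in> f" "(u, p) \<in> (hadj (?E - {f}))\<^sup>*"
    using hadj_reaches_edge w by metis
  have pu: "p \<noteq> u" using p f by auto
  obtain e0 where e0: "e0 \<in> ?E" "e0 \<noteq> f" "p \<in> e0"
    using p(2) pu by (cases rule: rtranclE) (auto simp: hadj_def)
  have ue0: "u \<in> e0" using u(2) e0 by blast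
  have share: "e = e'" if "e \<in> ?E" "e' \<in> ?E" "e \<noteq> f" "e' \<noteq> f" "v \<in> e" "v \<in> e'" "v \<noteq> u" for e e' v
    using edge_separating_inter[OF sep that(1,2) _ that(5,6)] u(2) that by blast
  have attach: "v = p \<and> e = e0" if "e \<in> ?E" "e \<noteq> f" "v \<in> e" "v \<in> f" for e v
  proof -
    have "(p, u) \<in> (hadj (?E - {f}))\<^sup>*" "(u, v) \<in> (hadj (?E - {f}))\<^sup>*"
      using hadj_rtrancl_edge[of e0 "?E - {f}"] hadj_rtrancl_edge[of e "?E - {f}"] that e0 ue0 u(2)
      by auto
    then have "p = v" using edge_separatingD[OF sep f(1) p(1) that(4)] by (auto dest: rtrancl_trans)
    then show ?thesis using share[OF that(1) e0(1) that(2) e0(2)] that e0 pu by auto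
  qed
  \<comment> \<open>\<open>q e\<close> is the core vertex of \<open>e\<close> nearer to
    \<open>u\<close>, \<open>c e\<close> the farther one. The latter is an arbitrary choice except
    on \<open>e0\<close>, where it must be \<open>p\<close> so that \<open>f\<close> is attached to
    the core.\<close>
  define q where "q = (\<lambda>e. if e = f then p else u)"
  have "\<exists>v. v \<in> e - {q e} \<and> (e = e0 \<longrightarrow> v = p)" if "e \<in> ?E" for e
    using big[OF that] e0 pu by (cases "e = e0") (auto simp: q_def)
  then obtain c where c: "\<And>e. e \<in> ?E \<Longrightarrow> c e \<in> e - {q e} \<and> (e = e0 \<longrightarrow> c e = p)" by metis
  have ce0: "c e0 = p" using c e0 by auto
  have cf: "c f \<in> f" "c f \<noteq> p" using c[OF f(1)] by (auto simp: q_def)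
  have ce: "c e \<in> e" "c e \<noteq> u" if "e \<in> ?E" for e using c[OF that] f by (auto simp: q_def split: if_splits)
  have cnf: "c e \<notin> f \<or> e = e0" if "e \<in> ?E" "e \<noteq> f" for e using attach[OF that] ce that by blast
  have injc: "inj_on c ?E"
  proof (rule inj_onI)
    fix e e' assume *: "e \<in> ?E" "e' \<in> ?E" "c e = c e'"
    show "e = e'"
      using share[of e e' "c e"] ce[of e] ce[of e'] * cnf[of e] cnf[of e'] cf ce0 by metis
  qed
  define C where "C = insert u (c ` ?E)"
  have eC: "e \<inter> C = {q e, c e}" if e: "e \<in> ?E" for e
  proof (cases "e = f")
    case True
    have "c e' \<in> f \<Longrightarrow> c e' = p \<or> e' = f" if "e' \<in> ?E" for e'
      using attach[OF that] ce[OF that] by blast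
    then show ?thesis using True f p(1) e0(1) ce0 cf by (auto simp: C_def q_def)
  next
    case False
    have "c e' = c e" if "e' \<in> ?E" "c e' \<in> e" for e'
    proof (cases "e' = f")
      case True
      then show ?thesis using attach[OF e False that(2)] cf by auto
    next
      case F: False
      then show ?thesis using share[OF that(1) e F False _ that(2)] ce[OF that(1)] by auto
    qed
    then have "e \<inter> c ` ?E = {c e}" using ce(1)[OF e] e by blast
    then show ?thesis using False u(2)[OF e False] by (simp add: C_def q_def)
  qed
  have qc: "q e \<noteq> c e" if "e \<in> ?E" for e using c[OF that] by auto
  have "card (?E - {e0, f}) = m - 2" using e0 f m fin(2) by (simp add: card_Diff_subset)
  then obtain \<iota>0 where \<iota>0: "bij_betw \<iota>0 (?E - {e0, f}) {3..<m + 1}"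
    using finite_same_card_bij[of "?E - {e0, f}" "{3..<m + 1}"] fin(2) by auto
  have m2: "2 \<le> m"
  proof -
    have "card {e0, f} \<le> m" unfolding m[symmetric] using e0 f fin(2) by (intro card_mono) auto
    then show ?thesis using e0 by simp
  qed
  \<comment> \<open>Labels of the far ends in \<open>double_star 1 (m - 2)\<close>: \<open>p\<close>
    is the end \<open>0\<close>, whose only pendant edge, that of \<open>f\<close>, has leaf
    \<open>2\<close>; \<open>u\<close> is the end \<open>1\<close> with leaves \<open>3\<close> to
    \<open>m\<close>.\<close>
  define \<iota> where "\<iota> = (\<lambda>e. if e = e0 then 0 else if e = f then 2 else \<iota>0 e)"
  have \<iota>f: "\<iota> f = 2" and \<iota>e0: "\<iota> e0 = 0" using e0 by (auto simp: \<iota>_def)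
  have \<iota>r: "\<iota> e \<in> {3..<m + 1}" if "e \<in> ?E - {e0, f}" for e
    using bij_betw_apply[OF \<iota>0 that] that by (simp add: \<iota>_def)
  have \<iota>im0: "\<iota> ` (?E - {e0, f}) = {3..<m + 1}"
    using \<iota>0 by (auto simp: bij_betw_def \<iota>_def)
  have \<iota>im1: "\<iota> ` (?E - {f}) = insert 0 {3..<m + 1}"
  proof -
    have "?E - {f} = insert e0 (?E - {e0, f})" using e0 by auto
    then have "\<iota> ` (?E - {f}) = insert (\<iota> e0) (\<iota> ` (?E - {e0, f}))" by (metis image_insert)
    then show ?thesis unfolding \<iota>im0 by (simp add: \<iota>_def)
  qed
  have \<iota>im: "\<iota> ` ?E = insert 2 (insert 0 {3..<m + 1})"
  proof -
    have "?E = insert f (?E - {f})" using f by auto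
    then show ?thesis using \<iota>im1 \<iota>f by (metis image_insert)
  qed
  have \<iota>cases: "(e = e0 \<and> \<iota> e = 0) \<or> (e = f \<and> \<iota> e = 2) \<or> (e \<notin> {e0, f} \<and> 3 \<le> \<iota> e)"
    if "e \<in> ?E" for e
    using \<iota>r[of e] \<iota>f \<iota>e0 that by (cases "e = e0"; cases "e = f") simp_all
  have inj\<iota>: "inj_on \<iota> ?E"
  proof (rule inj_onI)
    fix e e' assume *: "e \<in> ?E" "e' \<in> ?E" "\<iota> e = \<iota> e'"
    have inj0: "inj_on \<iota>0 (?E - {e0, f})" using \<iota>0 by (simp add: bij_betw_def)
    show "e = e'"
    proof (cases "e \<in> {e0, f} \<or> e' \<in> {e0, f}")
      case True
      with \<iota>cases[OF *(1)] \<iota>cases[OF *(2)] *(3) show ?thesis by (elim disjE[of "_ \<and> _"] conjE) simp_all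
    next
      case False
      then show ?thesis using * inj_onD[OF inj0, of e e'] by (simp add: \<iota>_def)
    qed
  qed
  have "u \<notin> c ` ?E" using ce by auto
  moreover have "1 \<notin> \<iota> ` ?E" unfolding \<iota>im by auto
  ultimately obtain h where h: "h u = 1" "\<And>e. e \<in> ?E \<Longrightarrow> h (c e) = \<iota> e"
    "bij_betw h C (insert 1 (\<iota> ` ?E))"
    using core_labelling[OF injc _ inj\<iota>, of u 1] unfolding C_def by metis
  have hp: "h p = 0" using h(2)[OF e0(1)] ce0 by (simp add: \<iota>_def)
  have he: "h ` (e \<inter> C) = (if e = f then {0, 2} else {1, \<iota> e})" if "e \<in> ?E" for e
    unfolding eC[OF that] using h that hp \<iota>f by (auto simp: q_def)
  show ?thesis
  proof (rule isomorphic_power_hypergraph[OF G])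
    show "C \<subseteq> verts T" using ce fin(4) u by (auto simp: C_def)
    have "insert 1 (\<iota> ` ?E) = verts (double_star 1 (m - 2))"
      unfolding \<iota>im using m2 by (auto simp: double_star_def)
    then show "bij_betw h C (verts (double_star 1 (m - 2)))" using h by simp
    have "inj_on (\<lambda>e. h ` (e \<inter> C)) ?E"
    proof (rule inj_onI)
      fix e e' assume *: "e \<in> ?E" "e' \<in> ?E" "h ` (e \<inter> C) = h ` (e' \<inter> C)"
      then have eq: "(if e = f then {0, 2} else {1, \<iota> e}) = (if e' = f then {0, 2} else {1, \<iota> e'})"
        by (simp only: he)
      show "e = e'"
      proof (cases "e = f \<or> e' = f")
        case True
        have "1 \<notin> {0, 2 :: nat}" by simp
        then show ?thesis using eq True by (metis insertI1)
      next
        case False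
        then have "{1, \<iota> e} = {1, \<iota> e'}" using eq by simp
        then have "\<iota> e = \<iota> e'" by (metis doubleton_eq_iff)
        then show ?thesis by (rule inj_onD[OF inj\<iota> _ *(1,2)])
      qed
    qed
    moreover have "(\<lambda>e. h ` (e \<inter> C)) ` ?E = edges (double_star 1 (m - 2))"
    proof -
      have "(\<lambda>e. h ` (e \<inter> C)) ` ?E = insert {0, 2} ((\<lambda>e. {1, \<iota> e}) ` (?E - {f}))"
      proof -
        have "?E = insert f (?E - {f})" using f by auto
        then have "(\<lambda>e. h ` (e \<inter> C)) ` ?E
            = insert (h ` (f \<inter> C)) ((\<lambda>e. h ` (e \<inter> C)) ` (?E - {f}))" by (metis image_insert)
        also have "(\<lambda>e. h ` (e \<inter> C)) ` (?E - {f}) = (\<lambda>e. {1, \<iota> e}) ` (?E - {f})"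
          by (rule image_cong) (auto simp: he)
        finally show ?thesis by (simp add: he f(1))
      qed
      also have "\<dots> = insert {0, 2} ((\<lambda>i. {1, i}) ` (\<iota> ` (?E - {f})))" by (simp add: image_image)
      also have "\<dots> = edges (double_star 1 (m - 2))"
      proof -
        have "{1 + 2..1 + (m - 2) + 1} = {3..<m + 1}" using m2 by auto
        then show ?thesis unfolding \<iota>im1 by (auto simp: double_star_def insert_commute)
      qed
      finally show ?thesis .
    qed
    ultimately show "bij_betw (\<lambda>e. h ` (e \<inter> C)) ?E (edges (double_star 1 (m - 2)))"
      by (simp add: bij_betw_def)
    show "card (e \<inter> C) = 2" if "e \<in> ?E" for e using eC[OF that] qc[OF that] by simp
    show "\<exists>!e. e \<in> ?E \<and> v \<in> e" if v: "v \<in> verts T - C" for v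
    proof -
      have vn: "v \<noteq> u" "v \<noteq> p" using v e0(1) ce0 by (auto simp: C_def)
      have "e = e'" if "e \<in> ?E" "e' \<in> ?E" "v \<in> e" "v \<in> e'" for e e'
        using share[of e e' v] attach[of e v] attach[of e' v] that vn by blast
      then show ?thesis using vertex_in_edge[OF conn u(1), of v] v vn by blast
    qed
  qed
qed

section \<open>The extremal supertree\<close>

lemma supertree_radius_improvement:
  assumes T: "supertree k T" and k: "3 \<le> k" and \<alpha>: "0 \<le> \<alpha>" "\<alpha> < 1"
    and nu: "\<not> (\<exists>u\<in>verts T. \<forall>e\<in>edges T. u \<in> e)"
    and nds: "\<not> isomorphic T (power_hypergraph k (double_star 1 (card (edges T) - 2)))"
  obtains E' where "supertree k \<lparr>verts = verts T, edges = E'\<rparr>" "card E' = card (edges T)"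
    "\<not> (\<exists>u\<in>verts T. \<forall>e\<in>E'. u \<in> e)"
    "alpha_spectral_radius k \<alpha> T < alpha_spectral_radius k \<alpha> \<lparr>verts = verts T, edges = E'\<rparr>"
proof -
  let ?E = "edges T" and ?V = "verts T"
  have G: "uniform k T" and conn: "hconnected T" and sep: "edge_separating ?E"
    using T by (auto simp: supertree_iff)
  have k2: "2 \<le> k" using k by simp
  note fin = uniform_finite[OF G]
  obtain x where pos: "\<forall>v\<in>?V. 0 < x v" and x1: "(\<Sum>v\<in>?V. x v ^ k) = 1"
    and xR: "tensor_form k \<alpha> ?E x = alpha_spectral_radius k \<alpha> T"
    by (rule alpha_spectral_radius_variational[OF G k2 \<alpha> conn])
  have neV: "?V \<noteq> {}" using conn by (simp add: hconnected_def)
  have "Max (x ` ?V) \<in> x ` ?V" using fin(1) neV by (intro Max_in) auto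
  then obtain u where u: "u \<in> ?V" "x u = Max (x ` ?V)" by auto
  have umax: "x v \<le> x u" if "v \<in> ?V" for v using u fin(1) that by auto
  obtain f where f: "f \<in> ?E" "u \<notin> f" using nu u(1) by blast
  \<comment> \<open>If \<open>f\<close> were the only edge missing \<open>u\<close>,
    \<open>T\<close> would be the excluded double star.\<close>
  obtain g where g: "g \<in> ?E" "u \<notin> g" "g \<noteq> f"
    using supertree_almost_universal_vertex[OF T k2 refl u(1) _ f] nds by blast
  have "f \<noteq> {}" using fin(5)[OF f(1)] k by auto
  then obtain w where w: "w \<in> f" by auto
  have "(u, w) \<in> (hadj ?E)\<^sup>*" using conn u(1) w fin(4)[OF f(1)] by (auto simp: hconnected_iff)
  then obtain p where p: "p \<in> f" "(u, p) \<in> (hadj (?E - {f}))\<^sup>*"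
    using hadj_reaches_edge w by metis
  define f' where "f' = insert u (f - {p})"
  define E' where "E' = insert f' (?E - {f})"
  define T' where "T' = \<lparr>verts = ?V, edges = E'\<rparr>"
  have T': "supertree k T'" and f'E: "f' \<notin> ?E"
    using edge_move_supertree[OF T k f(1) u(1) f(2) p] by (auto simp: T'_def E'_def f'_def)
  then have G': "uniform k T'" "hconnected T'" "edge_separating E'"
    by (auto simp: supertree_iff T'_def)
  have pu: "p \<noteq> u" using p f by auto
  \<comment> \<open>The first edge on the path from \<open>u\<close> to \<open>p\<close>; it
    survives the move.\<close>
  obtain h where h: "h \<in> ?E - {f}" "u \<in> h"
    using p(2) pu by (cases rule: converse_rtranclE) (auto simp: hadj_def)
  show ?thesis
  proof (rule that[of E'])
    show "supertree k \<lparr>verts = ?V, edges = E'\<rparr>" using T' by (simp add: T'_def)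
    have "card E' = Suc (card (?E - {f}))" using f'E fin(2) by (simp add: E'_def)
    also have "\<dots> = card ?E" by (rule card_Suc_Diff1[OF fin(2) f(1)])
    finally show "card E' = card ?E" .
    show "\<not> (\<exists>z\<in>?V. \<forall>e\<in>E'. z \<in> e)"
    proof (intro notI, elim bexE)
      \<comment> \<open>The edges \<open>f'\<close> and \<open>h\<close> meet only in
        \<open>u\<close>, so a common vertex of all edges could only be \<open>u\<close>, which
        \<open>g\<close> misses.\<close>
      fix z assume z: "\<forall>e\<in>E'. z \<in> e"
      then have "z \<in> g" "z \<in> f'" "z \<in> h" using g h by (auto simp: E'_def)
      moreover have "h \<noteq> f'" "h \<in> E'" "f' \<in> E'" "u \<in> f'" using h f'E by (auto simp: E'_def f'_def)
      ultimately have "z = u" using edge_separating_inter[OF G'(3)] h(2) by metis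
      then show False using \<open>z \<in> g\<close> g by simp
    qed
    show "alpha_spectral_radius k \<alpha> T < alpha_spectral_radius k \<alpha> \<lparr>verts = ?V, edges = E'\<rparr>"
      unfolding T'_def[symmetric]
    proof (rule edge_move_increases_radius[OF G k2 \<alpha> conn f(1) p(1) u(1) f(2) f'_def f'E])
      show "x p \<le> x u" using umax fin(4)[OF f(1)] p(1) by auto
    qed (use G' x1 xR pos in \<open>auto simp: T'_def E'_def\<close>)
  qed
qed

theorem theorem6p2:
  fixes T :: "'a hypergraph" and \<alpha> :: real and k n m :: nat
  assumes "k \<ge> 3" and "0 \<le> \<alpha>" and "\<alpha> < 1"
    and "supertree k T" and "card (verts T) = n" and "card (edges T) = m"
    and "\<not> isomorphic T (power_hypergraph k (star_graph m))"
  shows "alpha_spectral_radius k \<alpha> T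
           \<le> alpha_spectral_radius k \<alpha> (power_hypergraph k (double_star 1 (m - 2))) \<and>
         (alpha_spectral_radius k \<alpha> T
           = alpha_spectral_radius k \<alpha> (power_hypergraph k (double_star 1 (m - 2)))
          \<longleftrightarrow> isomorphic T (power_hypergraph k (double_star 1 (m - 2))))"
proof -
  let ?V = "verts T" and ?S = "power_hypergraph k (double_star 1 (m - 2))"
  let ?H = "\<lambda>E. \<lparr>verts = ?V, edges = E\<rparr>"
  let ?r = "\<lambda>E. alpha_spectral_radius k \<alpha> (?H E)"
  have k2: "2 \<le> k" using assms(1) by simp
  \<comment> \<open>A fixed vertex set makes the class finite. Non-stars are edge sets without a
    common vertex, the form that \<open>supertree_radius_improvement\<close> both takes and
    returns.\<close>
  define \<C> where "\<C> = {E. supertree k (?H E) \<and> card E = m \<and> \<not> (\<exists>u\<in>?V. \<forall>e\<in>E. u \<in> e)}"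
  have HT: "\<lparr>verts = verts T, edges = edges T\<rparr> = T" by simp
  have T\<C>: "edges T \<in> \<C>"
    using supertree_universal_vertex[OF assms(4) k2 assms(6)] assms(4,6,7) unfolding \<C>_def
    by (simp only: mem_Collect_eq HT) blast
  have "finite ?V" using assms(4) by (auto simp: supertree_def uniform_def)
  moreover have "\<C> \<subseteq> Pow (Pow ?V)" by (auto simp: \<C>_def supertree_def uniform_def)
  ultimately have fin: "finite \<C>" by (meson finite_Pow_iff finite_subset)
  have iso: "isomorphic (?H E) ?S" if E: "E \<in> \<C>" and max: "\<And>E'. E' \<in> \<C> \<Longrightarrow> ?r E' \<le> ?r E" for E
  proof (rule ccontr)
    assume "\<not> ?thesis"
    then have "\<not> isomorphic (?H E) (power_hypergraph k (double_star 1 (card (edges (?H E)) - 2)))"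
      using E by (simp add: \<C>_def)
    moreover have "supertree k (?H E)" "\<not> (\<exists>u\<in>verts (?H E). \<forall>e\<in>edges (?H E). u \<in> e)"
      using E by (auto simp: \<C>_def)
    ultimately obtain E' where "supertree k \<lparr>verts = verts (?H E), edges = E'\<rparr>" "card E' = card (edges (?H E))"
      "\<not> (\<exists>u\<in>verts (?H E). \<forall>e\<in>E'. u \<in> e)"
      "alpha_spectral_radius k \<alpha> (?H E) < alpha_spectral_radius k \<alpha> \<lparr>verts = verts (?H E), edges = E'\<rparr>"
      using supertree_radius_improvement[OF _ assms(1-3)] by metis
    then show False using max[of E'] E by (simp add: \<C>_def)
  qed
  have radius: "alpha_spectral_radius k \<alpha> G = alpha_spectral_radius k \<alpha> ?S"
    if "supertree k G" "isomorphic G ?S" for G :: "'a hypergraph"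
    using that by (intro alpha_spectral_radius_isomorphic[OF _ k2]) (auto simp: supertree_def)
  have "Max (?r ` \<C>) \<in> ?r ` \<C>" using fin T\<C> by (intro Max_in) auto
  then obtain E where E: "E \<in> \<C>" "?r E = Max (?r ` \<C>)" by auto
  have max: "?r E' \<le> ?r E" if "E' \<in> \<C>" for E' using that E(2) fin by simp
  \<comment> \<open>\<open>?S\<close> lives on another vertex type and is no member of
    \<open>\<C>\<close>; the extremal \<open>E\<close> represents it.\<close>
  have S: "?r E = alpha_spectral_radius k \<alpha> ?S"
    using radius[OF _ iso[OF E(1) max]] E(1) by (simp add: \<C>_def)
  have le: "alpha_spectral_radius k \<alpha> T \<le> alpha_spectral_radius k \<alpha> ?S"
    using max[OF T\<C>] S HT by simp
  \<comment> \<open>Equality makes \<open>edges T\<close> itself extremal in \<open>\<C>\<close>, so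
    \<open>iso\<close> applies to it.\<close>
  moreover have "isomorphic T ?S" if "alpha_spectral_radius k \<alpha> T = alpha_spectral_radius k \<alpha> ?S"
    using iso[OF T\<C>] max S that HT by simp
  ultimately show ?thesis using radius[OF assms(4)] by blast
qed

end
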